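(* Let $n\ge 1$ and let $K_0,K_1,\dots,K_n$ be strictly concave kernel functions such that either all of them satisfy condition $(\infty')$, or all of them belong to $\mathrm{C}^1(0,2\pi)$. For $\mathbf{y}=(y_1,\dots,y_n)\in\mathbb{T}^n$ let $F(\mathbf{y},t)=K_0(t)+\sum_{j=1}^nK_j(t-y_j)$. Then there is $\mathbf{w}^*=(w_1,\dots,w_n)\in\mathbb{T}^n$ with \[M:=\inf_{\mathbf{y}\in\mathbb{T}^n}\sup_{t\in\mathbb{T}}F(\mathbf{y},t)=\sup_{t\in\mathbb{T}}F(\mathbf{w}^*,t).\] Moreover: (a) $\mathbf{w}^*$ is an equioscillation point, i.e. $m_0(\mathbf{w}^* )=\dots=m_n(\mathbf{w}^* )$; (b) $\mathbf{w}^*\in S:=S_\sigma$ for some permutation $\sigma$ (so the nodes $0,w_1,\dots,w_n$ are pairwise different), and \[M(S)=\inf_{\mathbf{y}\in S}\max_{j=0,\dots,n}\sup_{t\in I_j(\mathbf{y})}F(\mathbf{y},t)=M=\sup_{\mathbf{y}\in S}\min_{j=0,\dots,n}\sup_{t\in I_j(\mathbf{y})}F(\mathbf{y},t)=m(S);\] (c) the Sandwich Property holds on $S$: for all $\mathbf{x},\mathbf{y}\in S$, $\underline{m}(\mathbf{x})\le M\le\overline{m}(\mathbf{y})$.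
   Context: Identify the torus $\mathbb{T}=\mathbb{R}/2\pi\mathbb{Z}$ with $[0,2\pi)$. A concave kernel function is a $2\pi$-periodic function $K:\mathbb{R}\to[-\infty,\infty)$ which is real-valued and concave on $(0,2\pi)$ and such that $\lim_{t\downarrow0}K(t)$ and $\lim_{t\uparrow2\pi}K(t)$ exist in $[-\infty,\infty)$ and are equal (their common value being $K(0)=K(2\pi)$); it is strictly concave if it is strictly concave on $(0,2\pi)$. $D_\pm$ denote one-sided derivatives. Condition $(\infty')$ for $K$: either $\lim_{t\uparrow2\pi}D_-K(t)=\lim_{t\uparrow2\pi}D_+K(t)=-\infty$, or $\lim_{t\downarrow0}D_-K(t)=\lim_{t\downarrow0}D_+K(t)=+\infty$. For a node system $\mathbf{y}\in\mathbb{T}^n$ put $y_0=0$, $y_{n+1}=2\pi$. For a permutation $\sigma$ of $\{1,\dots,n\}$ set $\sigma(0)=0,\sigma(n+1)=n+1$ and define the simplex $S_\sigma=\{\mathbf{y}\in\mathbb{T}^n:0<y_{\sigma(1)}<\dots<y_{\sigma(n)}<2\pi\}$; its closure consists of the $\mathbf{y}$ with $0\le y_{\sigma(1)}\le\dots\le y_{\sigma(n)}\le2\pi$. For $\mathbf{y}\in\overline{S_\sigma}$ and $k=0,\dots,n$, $I_{\sigma(k)}(\mathbf{y})=[y_{\sigma(k)},y_{\sigma(k+1)}]$ and $m_{\sigma(k)}(\mathbf{y})=\sup_{t\in I_{\sigma(k)}(\mathbf{y})}F(\mathbf{y},t)$ (the permutation being fixed). $\overline{m}(\mathbf{y})=\max_jm_j(\mathbf{y})=\sup_{t\in\mathbb{T}}F(\mathbf{y},t)$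 and $\underline{m}(\mathbf{y})=\min_jm_j(\mathbf{y})$. For $A\subseteq\mathbb{T}^n$, $M(A)=\inf_{\mathbf{y}\in A}\overline{m}(\mathbf{y})$ and $m(A)=\sup_{\mathbf{y}\in A}\underline{m}(\mathbf{y})$. A point $\mathbf{y}$ (of the closure of a fixed simplex) is an equioscillation point if $m_0(\mathbf{y})=\dots=m_n(\mathbf{y})$. *)

theory Defs
  imports "HOL-Analysis.Analysis" "HOL-Combinatorics.Permutations" "HOL-Library.FuncSet"
begin

definition strictly_concave_on :: "real set \<Rightarrow> (real \<Rightarrow> real) \<Rightarrow> bool" where
  "strictly_concave_on S f \<longleftrightarrow> convex S \<and>
     (\<forall>x\<in>S. \<forall>y\<in>S. x \<noteq> y \<longrightarrow> (\<forall>u::real. 0 < u \<and> u < 1 \<longrightarrow>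
        f (u * x + (1 - u) * y) > u * f x + (1 - u) * f y))"

text \<open>Kernels take values in [-infinity, infinity), modelled as ereal with no +infinity value.
  Real-valued on (0,2pi), 2pi-periodic, one-sided limits at 0 and 2pi exist and equal K 0.\<close>
definition kernel_base :: "(real \<Rightarrow> ereal) \<Rightarrow> bool" where
  "kernel_base K \<longleftrightarrow>
     (\<forall>t. K (t + 2*pi) = K t) \<and>
     (\<forall>t. K t \<noteq> \<infinity>) \<and>
     (\<forall>t\<in>{0<..<2*pi}. K t \<noteq> -\<infinity>) \<and>
     (K \<longlongrightarrow> K 0) (at_right 0) \<and>
     (K \<longlongrightarrow> K 0) (at_left (2*pi))"

definition concave_kernel :: "(real \<Rightarrow> ereal) \<Rightarrow> bool" where
  "concave_kernel K \<longleftrightarrow> kernel_base K \<and>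
     concave_on {0<..<2*pi} (\<lambda>t. real_of_ereal (K t))"

definition strictly_concave_kernel :: "(real \<Rightarrow> ereal) \<Rightarrow> bool" where
  "strictly_concave_kernel K \<longleftrightarrow> concave_kernel K \<and>
     strictly_concave_on {0<..<2*pi} (\<lambda>t. real_of_ereal (K t))"

text \<open>One-sided derivatives (they exist in the interior for concave functions).\<close>
definition Dplus :: "(real \<Rightarrow> real) \<Rightarrow> real \<Rightarrow> real" where
  "Dplus f t = Lim (at_right 0) (\<lambda>h. (f (t + h) - f t) / h)"

definition Dminus :: "(real \<Rightarrow> real) \<Rightarrow> real \<Rightarrow> real" where
  "Dminus f t = Lim (at_left 0) (\<lambda>h. (f (t + h) - f t) / h)"

definition cond_infty' :: "(real \<Rightarrow> ereal) \<Rightarrow> bool" where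
  "cond_infty' K \<longleftrightarrow>
     (let k = (\<lambda>t. real_of_ereal (K t)) in
       (filterlim (Dminus k) at_bot (at_left (2*pi)) \<and>
        filterlim (Dplus k) at_bot (at_left (2*pi)))
     \<or> (filterlim (Dminus k) at_top (at_right 0) \<and>
        filterlim (Dplus k) at_top (at_right 0)))"

definition C1_kernel :: "(real \<Rightarrow> ereal) \<Rightarrow> bool" where
  "C1_kernel K \<longleftrightarrow> (\<exists>K'. (\<forall>t\<in>{0<..<2*pi}.
        ((\<lambda>s. real_of_ereal (K s)) has_real_derivative K' t) (at t))
      \<and> continuous_on {0<..<2*pi} K')"

text \<open>Node systems y in T^n, T identified with [0,2pi); components y 1, ..., y n.\<close>
definition nodes :: "nat \<Rightarrow> (nat \<Rightarrow> real) set" where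
  "nodes n = ({1..n} \<rightarrow>\<^sub>E {0..<2*pi})"

definition ynode :: "nat \<Rightarrow> (nat \<Rightarrow> real) \<Rightarrow> nat \<Rightarrow> real" where
  "ynode n y k = (if k = 0 then 0 else if k = n + 1 then 2*pi else y k)"

definition Fsum :: "nat \<Rightarrow> (nat \<Rightarrow> real \<Rightarrow> ereal) \<Rightarrow> (nat \<Rightarrow> real) \<Rightarrow> real \<Rightarrow> ereal" where
  "Fsum n K y t = K 0 t + (\<Sum>j\<in>{1..n}. K j (t - y j))"

text \<open>Open simplex S_sigma (sigma permutes {1..n}, hence fixes 0 and n+1).\<close>
definition Ssimplex :: "nat \<Rightarrow> (nat \<Rightarrow> nat) \<Rightarrow> (nat \<Rightarrow> real) set" where
  "Ssimplex n \<sigma> = {y \<in> nodes n. \<forall>k\<in>{0..n}. ynode n y (\<sigma> k) < ynode n y (\<sigma> (k + 1))}"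

text \<open>m_{sigma(k)}(y) = sup of F over I_{sigma(k)}(y) = [y_sigma(k), y_sigma(k+1)].\<close>
definition mloc :: "nat \<Rightarrow> (nat \<Rightarrow> real \<Rightarrow> ereal) \<Rightarrow> (nat \<Rightarrow> nat) \<Rightarrow> (nat \<Rightarrow> real) \<Rightarrow> nat \<Rightarrow> ereal" where
  "mloc n K \<sigma> y k = (SUP t\<in>{ynode n y (\<sigma> k)..ynode n y (\<sigma> (k + 1))}. Fsum n K y t)"

definition mbar :: "nat \<Rightarrow> (nat \<Rightarrow> real \<Rightarrow> ereal) \<Rightarrow> (nat \<Rightarrow> nat) \<Rightarrow> (nat \<Rightarrow> real) \<Rightarrow> ereal" where
  "mbar n K \<sigma> y = Max ((mloc n K \<sigma> y) ` {0..n})"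

definition munder :: "nat \<Rightarrow> (nat \<Rightarrow> real \<Rightarrow> ereal) \<Rightarrow> (nat \<Rightarrow> nat) \<Rightarrow> (nat \<Rightarrow> real) \<Rightarrow> ereal" where
  "munder n K \<sigma> y = Min ((mloc n K \<sigma> y) ` {0..n})"

definition equioscillation :: "nat \<Rightarrow> (nat \<Rightarrow> real \<Rightarrow> ereal) \<Rightarrow> (nat \<Rightarrow> nat) \<Rightarrow> (nat \<Rightarrow> real) \<Rightarrow> bool" where
  "equioscillation n K \<sigma> y \<longleftrightarrow> (\<forall>k\<in>{0..n}. mloc n K \<sigma> y k = mloc n K \<sigma> y 0)"

end

theory Submission
  imports Defs
begin

text \<open>
  On each simplex every local maximum \<open>m\<^sub>j\<close> is a strictly concave function of the nodes, because
  \<open>(y, t) \<mapsto> F(y, t)\<close> is jointly concave while \<open>t\<close> stays in the \<open>j\<close>-th arc. Moreover \<open>F(y, \<cdot>)\<close> never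
  attains its maximum at a node: there it has an infinite one-sided slope under \<open>(\<infinity>')\<close>, and a convex kink
  in the \<open>C\<^sup>1\<close> case. Let \<open>w\<close> be a global minimizer of the maximum \<open>M\<close>. By strict concavity \<open>F(w, \<cdot>)\<close>
  attains \<open>M\<close> at most once between consecutive nodes. If it did so at no more than \<open>n\<close> points, then their
  supergradients would admit a common non-increasing direction \<open>v \<noteq> 0\<close> in \<open>\<real>\<^sup>n\<close>, and moving the nodes along
  \<open>v\<close> would strictly lower the maximum. So there are \<open>n + 1\<close> such points: the nodes are distinct and \<open>w\<close>
  equioscillates. If all \<open>m\<^sub>j(x) > M\<close> for some \<open>x\<close> in the same simplex, then by concavity all \<open>m\<^sub>j\<close> would be
  below \<open>M\<close> at \<open>w + s(w - x)\<close> for small \<open>s > 0\<close>, contradicting minimality.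
\<close>

section \<open>One-sided derivatives and linear inequalities\<close>

text \<open>The middle point is the convex combination with weight \<open>(z - y) / (z - x)\<close>
  on \<open>x\<close>. Strict concavity at this weight, solved for the increments, gives both chord
  comparisons.\<close>

lemma strictly_concave_on_slopes:
  assumes "strictly_concave_on S f" "x \<in> S" "z \<in> S" "x < y" "y < z"
  shows "(f z - f x) / (z - x) < (f y - f x) / (y - x)"
    and "(f z - f y) / (z - y) < (f z - f x) / (z - x)"
proof -
  define u where "u = (z - y) / (z - x)"
  have u: "0 < u" "u < 1" using assms by (auto simp: u_def field_simps)
  have yu: "u * x + (1 - u) * z = y"
  proof -
    have "u * (z - x) = z - y" using assms by (simp add: u_def)
    then show ?thesis by (simp add: algebra_simps)
  qed
  have "f (u * x + (1 - u) * z) > u * f x + (1 - u) * f z"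
    using assms u unfolding strictly_concave_on_def by force
  then have *: "f y > u * f x + (1 - u) * f z" by (simp add: yu)
  have u1: "1 - u = (y - x) / (z - x)" using assms by (simp add: u_def field_simps)
  have "f y - f x > (1 - u) * (f z - f x)" using * by (simp add: algebra_simps)
  then show "(f z - f x) / (z - x) < (f y - f x) / (y - x)"
    using assms unfolding u1 by (simp add: field_simps)
  have "f z - f y < u * (f z - f x)" using * by (simp add: algebra_simps)
  then show "(f z - f y) / (z - y) < (f z - f x) / (z - x)"
    using assms unfolding u_def by (simp add: field_simps)
qed

text \<open>\<open>Dplus\<close> is defined by \<open>Lim\<close>, which carries information only
  once convergence is known. The difference quotients are monotone in \<open>h\<close> and bounded
  by the slope of a chord from the left, so they converge.\<close>

lemma Dplus_tendsto:
  assumes f: "strictly_concave_on {a<..<b} f" and t: "t \<in> {a<..<b}"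
  shows "((\<lambda>h. (f (t + h) - f t) / h) \<longlongrightarrow> Dplus f t) (at_right 0)"
proof -
  define q where "q h = - ((f (t + h) - f t) / h)" for h
  define I where "I = {..<b - t}"
  obtain s where s: "a < s" "s < t" using t dense by auto
  have mono: "q h \<le> q h'" if "h' \<in> I" "0 < h" "h \<le> h'" for h h'
  proof (cases "h = h'")
    case False
    then show ?thesis
      using strictly_concave_on_slopes(1)[OF f, of t "t + h'" "t + h"] that t by (simp add: q_def I_def)
  qed auto
  have bd: "- ((f t - f s) / (t - s)) \<le> q h" if "h \<in> I" "0 < h" for h
    using strictly_concave_on_slopes[OF f, of s "t + h" t] that s t
    by (simp add: q_def I_def)
  have "(q \<longlongrightarrow> Inf (q ` ({0<..} \<inter> I))) (at 0 within ({0<..} \<inter> I))"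
    by (rule Lim_right_bound) (use mono bd in auto)
  moreover have "at 0 within ({0<..} \<inter> I) = at_right (0::real)"
    by (rule at_within_nhd[of _ I]) (use t in \<open>auto simp: I_def\<close>)
  ultimately obtain l where "(q \<longlongrightarrow> l) (at_right 0)" by metis
  then have l: "((\<lambda>h. (f (t + h) - f t) / h) \<longlongrightarrow> - l) (at_right 0)"
    using tendsto_minus[of q l "at_right 0"] by (simp add: q_def)
  then have "Dplus f t = - l"
    unfolding Dplus_def by (intro tendsto_Lim) auto
  with l show ?thesis by simp
qed

lemma Dplus_gt_slope:
  assumes f: "strictly_concave_on {a<..<b} f" and "t \<in> {a<..<b}" "s \<in> {a<..<b}" "t < s"
  shows "(f s - f t) / (s - t) < Dplus f t"
proof -
  \<comment> \<open>A limit preserves only the weak inequality. The chord to the midpoint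
    \<open>r\<close> leaves room for a strict one.\<close>
  define r where "r = (t + s) / 2"
  have r: "t < r" "r < s" using assms by (auto simp: r_def)
  have "(f s - f t) / (s - t) < (f r - f t) / (r - t)"
    using strictly_concave_on_slopes[OF f, of t s r] assms r by auto
  also have "\<dots> \<le> Dplus f t"
  proof (rule tendsto_lowerbound[OF Dplus_tendsto[OF f assms(2)]])
    have "\<forall>\<^sub>F h in at_right 0. h \<in> {0<..<r - t}"
      using r by (intro eventually_at_right_real) auto
    then show "\<forall>\<^sub>F h in at_right 0. (f r - f t) / (r - t) \<le> (f (t + h) - f t) / h"
    proof eventually_elim
      case (elim h)
      then show ?case
        using strictly_concave_on_slopes(1)[OF f, of t r "t + h"] assms r by auto
    qed
  qed auto
  finally show ?thesis .
qed

lemma Dplus_lt_slope: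
  assumes f: "strictly_concave_on {a<..<b} f" and "t \<in> {a<..<b}" "s \<in> {a<..<b}" "s < t"
  shows "Dplus f t < (f t - f s) / (t - s)"
proof -
  define r where "r = (t + s) / 2"
  have r: "s < r" "r < t" using assms by (auto simp: r_def)
  have "Dplus f t \<le> (f t - f r) / (t - r)"
  proof (rule tendsto_upperbound[OF Dplus_tendsto[OF f assms(2)]])
    have "\<forall>\<^sub>F h in at_right 0. h \<in> {0<..<b - t}"
      using assms by (intro eventually_at_right_real) auto
    then show "\<forall>\<^sub>F h in at_right 0. (f (t + h) - f t) / h \<le> (f t - f r) / (t - r)"
    proof eventually_elim
      case (elim h)
      then show ?case
        using strictly_concave_on_slopes[OF f, of r "t + h" t] assms r by auto
    qed
  qed auto
  also have "\<dots> < (f t - f s) / (t - s)"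
    using strictly_concave_on_slopes[OF f, of s t r] assms r by auto
  finally show ?thesis .
qed

text \<open>The left derivative of \<open>f\<close> at \<open>x\<close> equals minus the right
  derivative of the reflected function at \<open>-x\<close>, so facts about \<open>Dplus\<close>
  also serve for left derivatives.\<close>

lemma strictly_concave_on_reflect:
  assumes "strictly_concave_on {a<..<b} f"
  shows "strictly_concave_on {-b<..<-a} (\<lambda>t. f (- t))"
proof -
  have "u * f (- x) + (1 - u) * f (- y) < f (- (u * x + (1 - u) * y))"
    if "x \<in> {-b<..<-a}" "y \<in> {-b<..<-a}" "x \<noteq> y" "0 < u" "u < 1" for x y u
  proof -
    have "- x \<in> {a<..<b}" "- y \<in> {a<..<b}" "- x \<noteq> - y" using that by auto
    then have "f (u * (- x) + (1 - u) * (- y)) > u * f (- x) + (1 - u) * f (- y)"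
      using assms that unfolding strictly_concave_on_def by blast
    then show ?thesis by (simp add: algebra_simps)
  qed
  then show ?thesis unfolding strictly_concave_on_def by auto
qed

lemma strictly_concave_on_shift:
  assumes "strictly_concave_on {a<..<b} f"
  shows "strictly_concave_on {a + c<..<b + c} (\<lambda>t. f (t - c))"
proof -
  have "u * f (x - c) + (1 - u) * f (y - c) < f (u * x + (1 - u) * y - c)"
    if "x \<in> {a + c<..<b + c}" "y \<in> {a + c<..<b + c}" "x \<noteq> y" "0 < u" "u < 1" for x y u
  proof -
    have "x - c \<in> {a<..<b}" "y - c \<in> {a<..<b}" "x - c \<noteq> y - c" using that by auto
    then have "f (u * (x - c) + (1 - u) * (y - c)) > u * f (x - c) + (1 - u) * f (y - c)"
      using assms that unfolding strictly_concave_on_def by blast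
    then show ?thesis by (simp add: algebra_simps)
  qed
  then show ?thesis unfolding strictly_concave_on_def by auto
qed

text \<open>Any slope between the right and the left derivative gives a supporting line, touching
  the graph only at \<open>x\<close>: chords to the right are flatter than the right derivative, and
  chords to the left are treated by reflection.\<close>

lemma strictly_concave_on_tangent:
  assumes f: "strictly_concave_on {a<..<b} f" and x: "x \<in> {a<..<b}" "x' \<in> {a<..<b}" "x' \<noteq> x"
    and s: "Dplus f x \<le> s" "s \<le> - Dplus (\<lambda>t. f (- t)) (- x)"
  shows "f x' < f x + s * (x' - x)"
proof (cases "x < x'")
  case True
  then have "(f x' - f x) / (x' - x) < s"
    using Dplus_gt_slope[OF f, of x x'] x s by auto
  then show ?thesis using True by (simp add: field_simps)
next
  case False
  then have l: "x' < x" using x by auto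
  have "(f x' - f x) / (- x' + x) < Dplus (\<lambda>t. f (- t)) (- x)"
    using Dplus_gt_slope[OF strictly_concave_on_reflect[OF f], of "-x" "-x'"] x l by auto
  then have "(f x' - f x) / (- x' + x) < - s" using s by auto
  then show ?thesis using l by (simp add: field_simps)
qed

text \<open>Ensures that the interval of supporting slopes is nonempty.\<close>

lemma Dplus_le_left_derivative:
  assumes f: "strictly_concave_on {a<..<b} f" and x: "x \<in> {a<..<b}"
  shows "Dplus f x \<le> - Dplus (\<lambda>t. f (- t)) (- x)"
proof -
  have "Dplus (\<lambda>t. f (- t)) (- x) \<le> - Dplus f x"
  proof (rule tendsto_upperbound[OF Dplus_tendsto[OF strictly_concave_on_reflect[OF f]]])
    have "\<forall>\<^sub>F h in at_right 0. h \<in> {0<..<x - a}"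
      using x by (intro eventually_at_right_real) auto
    then show "\<forall>\<^sub>F h in at_right 0. (f (- (- x + h)) - f (- (- x))) / h \<le> - Dplus f x"
    proof eventually_elim
      case (elim h)
      then have "Dplus f x < (f x - f (x - h)) / h"
        using Dplus_lt_slope[OF f, of x "x - h"] x by auto
      moreover have "(f (x - h) - f x) / h = - ((f x - f (x - h)) / h)"
        by (simp add: minus_divide_left)
      ultimately show ?case by simp
    qed
  qed (use x in auto)
  then show ?thesis by auto
qed

section \<open>Homogeneous linear systems and inequalities\<close>

text \<open>Gaussian elimination by induction on the equations: a pivot unknown \<open>p\<close> of
  the new equation is eliminated from all the others.\<close>

lemma homogeneous_solution:
  fixes a :: "'z \<Rightarrow> 'k \<Rightarrow> real"
  assumes "finite Z" "finite I" "card Z < card I"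
  shows "\<exists>v. (\<exists>k\<in>I. v k \<noteq> 0) \<and> (\<forall>z\<in>Z. (\<Sum>k\<in>I. a z k * v k) = 0)"
  using assms
proof (induction Z arbitrary: a I rule: finite_induct)
  case empty
  then have "I \<noteq> {}" by auto
  then show ?case by (intro exI[of _ "\<lambda>_. 1"]) auto
next
  case (insert z0 Z)
  show ?case
  proof (cases "\<forall>k\<in>I. a z0 k = 0")
    case True
    obtain v where "\<exists>k\<in>I. v k \<noteq> 0" "\<forall>z\<in>Z. (\<Sum>k\<in>I. a z k * v k) = 0"
      using insert.IH[of I a] insert.prems insert.hyps by force
    then show ?thesis using True by (intro exI[of _ v]) (auto intro!: sum.neutral)
  next
    case False
    then obtain p where p: "p \<in> I" "a z0 p \<noteq> 0" by auto
    define J where "J = I - {p}"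
    have J: "finite J" "card Z < card J" "p \<notin> J" "I = insert p J"
      using insert p by (auto simp: J_def)
    obtain v where v: "\<exists>k\<in>J. v k \<noteq> 0"
        "\<forall>z\<in>Z. (\<Sum>k\<in>J. (a z k - a z p / a z0 p * a z0 k) * v k) = 0"
      using insert.IH[of J "\<lambda>z k. a z k - a z p / a z0 p * a z0 k"] J by auto
    define S where "S z = (\<Sum>k\<in>J. a z k * v k)" for z
    \<comment> \<open>Back substitution: the value at \<open>p\<close> is chosen to satisfy equation
      \<open>z0\<close>.\<close>
    define v' where "v' = v(p := - S z0 / a z0 p)"
    have sum: "(\<Sum>k\<in>I. a z k * v' k) = a z p * (- S z0 / a z0 p) + S z" for z
    proof -
      have "(\<Sum>k\<in>J. a z k * v' k) = S z"
        unfolding S_def by (rule sum.cong) (use J in \<open>auto simp: v'_def\<close>)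
      then show ?thesis using J by (simp add: v'_def)
    qed
    have "(\<Sum>k\<in>I. a z k * v' k) = 0" if "z \<in> Z" for z
    proof -
      have "S z - a z p / a z0 p * S z0 = 0"
        using v(2) that by (simp add: S_def algebra_simps sum_subtractf sum_distrib_left)
      then show ?thesis by (simp add: sum)
    qed
    moreover have "(\<Sum>k\<in>I. a z0 k * v' k) = 0" using p by (simp add: sum)
    moreover have "\<exists>k\<in>I. v' k \<noteq> 0" using v(1) J by (auto simp: v'_def)
    ultimately show ?thesis by (intro exI[of _ v']) auto
  qed
qed

text \<open>One inequality \<open>z0\<close> is set aside, the others are solved as equations, and
  the sign of the solution is then chosen to suit \<open>z0\<close>.\<close>

lemma homogeneous_inequalities_solution:
  fixes a :: "'z \<Rightarrow> 'k \<Rightarrow> real"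
  assumes "finite Z" "finite I" "I \<noteq> {}" "card Z \<le> card I"
  shows "\<exists>v. (\<exists>k\<in>I. v k \<noteq> 0) \<and> (\<forall>z\<in>Z. (\<Sum>k\<in>I. a z k * v k) \<ge> 0)"
proof (cases "Z = {}")
  case True
  then show ?thesis using assms(3) by (intro exI[of _ "\<lambda>_. 1"]) auto
next
  case False
  then obtain z0 where z0: "z0 \<in> Z" by auto
  then have "card (Z - {z0}) < card I"
    using assms card_Diff1_less[of Z z0] by linarith
  then obtain v where v: "\<exists>k\<in>I. v k \<noteq> 0" "\<forall>z\<in>Z - {z0}. (\<Sum>k\<in>I. a z k * v k) = 0"
    using homogeneous_solution[of "Z - {z0}" I a] assms by auto
  define e :: real where "e = (if (\<Sum>k\<in>I. a z0 k * v k) \<ge> 0 then 1 else - 1)"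
  have e: "(\<Sum>k\<in>I. a z k * (e * v k)) = e * (\<Sum>k\<in>I. a z k * v k)" for z
    by (simp add: sum_distrib_left algebra_simps)
  have "(\<Sum>k\<in>I. a z k * (e * v k)) \<ge> 0" if "z \<in> Z" for z
    using v(2) that by (cases "z = z0") (auto simp only: e, auto simp: e_def)
  moreover have "\<exists>k\<in>I. e * v k \<noteq> 0" using v(1) by (auto simp: e_def)
  ultimately show ?thesis by (intro exI[of _ "\<lambda>k. e * v k"]) auto
qed

section \<open>Kernels\<close>

text \<open>The components of the real line without the lattice of multiples of 2 pi. On each of
  them a kernel is finite and strictly concave, and as long as \<open>t - y j\<close> stays in one
  branch, \<open>t\<close> does not cross the node \<open>y j\<close> modulo 2 pi.\<close>

definition branch :: "int \<Rightarrow> real set" where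
  "branch l = {2 * pi * of_int l<..<2 * pi * (of_int l + 1)}"

lemma branch_cases:
  fixes x :: real
  obtains l where "x = 2 * pi * of_int l" | l where "x \<in> branch l"
proof -
  define l where "l = \<lfloor>x / (2 * pi)\<rfloor>"
  have "of_int l \<le> x / (2 * pi)" "x / (2 * pi) < of_int l + 1"
    by (auto simp: l_def)
  then have "2 * pi * of_int l \<le> x" "x < 2 * pi * (of_int l + 1)"
    by (auto simp: field_simps)
  then consider "x = 2 * pi * of_int l" | "x \<in> branch l"
    unfolding branch_def by fastforce
  then show ?thesis using that by cases
qed

lemma open_branch: "open (branch l)"
  by (simp add: branch_def)

lemma branch_shift_iff: "x \<in> branch l \<longleftrightarrow> x - 2 * pi * of_int l \<in> {0<..<2 * pi}"
  by (auto simp: branch_def algebra_simps)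

lemma eventually_in_branch: "\<forall>\<^sub>F h in at 0. \<exists>l. x + h \<in> branch l"
proof (cases x rule: branch_cases)
  case (1 l)
  have "\<forall>\<^sub>F h in at (0::real). h \<in> {-(2*pi)<..<2*pi} - {0}"
    by (rule eventually_at_in_open) auto
  then show ?thesis
  proof eventually_elim
    case (elim h)
    then show ?case using 1
      by (cases "h > 0") (auto simp: branch_def algebra_simps intro: exI[of _ l] exI[of _ "l - 1"])
  qed
next
  case (2 l)
  have "((\<lambda>h. x + h) \<longlongrightarrow> x) (at 0)" by (auto intro!: tendsto_eq_intros)
  then have "\<forall>\<^sub>F h in at 0. x + h \<in> branch l"
    using topological_tendstoD[OF _ open_branch 2] by blast
  then show ?thesis by eventually_elim auto
qed

context
  fixes K :: "real \<Rightarrow> ereal"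
  assumes K: "strictly_concave_kernel K"
begin

lemma kernel_base: "kernel_base K"
  using K by (simp add: strictly_concave_kernel_def concave_kernel_def)

lemma kernel_not_PInf: "K t \<noteq> \<infinity>"
  using kernel_base by (simp add: kernel_base_def)

lemma kernel_periodic: "K (t + 2 * pi * of_int l) = K t"
proof -
  have p: "K (t + 2 * pi) = K t" for t using kernel_base by (simp add: kernel_base_def)
  have n: "K (t + 2 * pi * real m) = K t" for m t
  proof (induction m)
    case (Suc m)
    then show ?case using p[of "t + 2 * pi * real m"] by (simp add: algebra_simps)
  qed simp
  show ?thesis
  proof (cases l rule: int_cases2)
    case (nonneg m)
    then show ?thesis using n[of t m] by simp
  next
    case (nonpos m)
    then show ?thesis using n[of "t - 2 * pi * real m" m] by simp
  qed
qed

lemma kernel_shift: "K (t - 2 * pi * of_int l) = K t"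
  using kernel_periodic[of t "- l"] by simp

lemma kernel_finite: "x \<in> branch l \<Longrightarrow> \<bar>K x\<bar> \<noteq> \<infinity>"
  using kernel_base kernel_shift[of x l] unfolding kernel_base_def branch_shift_iff
  by (metis ereal_infinity_cases)

lemma kernel_strictly_concave: "strictly_concave_on (branch l) (\<lambda>t. real_of_ereal (K t))"
proof -
  have "strictly_concave_on {0 + 2*pi * of_int l<..<2*pi + 2*pi * of_int l}
      (\<lambda>t. real_of_ereal (K (t - 2*pi * of_int l)))"
    by (rule strictly_concave_on_shift) (use K in \<open>simp add: strictly_concave_kernel_def\<close>)
  moreover have "2*pi + 2*pi * of_int l = 2 * pi * (of_int l + 1)" by (simp add: algebra_simps)
  ultimately show ?thesis by (simp add: kernel_shift branch_def)
qed

lemma kernel_strictly_concave_0: "strictly_concave_on {0<..<2*pi} (\<lambda>t. real_of_ereal (K t))"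
  using kernel_strictly_concave[of 0] by (simp add: branch_def)

lemma kernel_tendsto_0: "(K \<longlongrightarrow> K 0) (at_right 0)" "(K \<longlongrightarrow> K 0) (at_left (2*pi))"
  using kernel_base by (auto simp: kernel_base_def)

text \<open>Continuity is that of \<open>ereal\<close>, so a value of minus infinity at lattice
  points is covered. Inside a branch it comes from concavity; at 0 the two one-sided limits are
  glued by periodicity.\<close>

lemma isCont_kernel: "isCont K x"
proof -
  have *: "isCont K r" if "0 \<le> r" "r < 2 * pi" for r
  proof (cases "r = 0")
    case True
    have "filterlim (\<lambda>t. t + 2 * pi) (at_left (2*pi)) (at_left 0)"
      unfolding filterlim_at
      by (auto intro!: tendsto_eq_intros simp: eventually_at_filter)
    then have "((\<lambda>t. K (t + 2 * pi)) \<longlongrightarrow> K 0) (at_left 0)"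
      using filterlim_compose[OF kernel_tendsto_0(2)] by blast
    then have "(K \<longlongrightarrow> K 0) (at_left 0)"
      using kernel_periodic[of _ 1] by simp
    then show ?thesis using True kernel_tendsto_0(1)
      by (simp add: isCont_def filterlim_split_at)
  next
    case False
    then have r: "r \<in> {0<..<2*pi}" using that by auto
    have "concave_on {0<..<2*pi} (\<lambda>t. real_of_ereal (K t))"
      using K by (simp add: strictly_concave_kernel_def concave_kernel_def)
    then have "continuous_on {0<..<2*pi} (\<lambda>t. - real_of_ereal (K t))"
      by (intro convex_on_continuous) (auto simp: concave_on_def)
    then have "continuous_on {0<..<2*pi} (\<lambda>t. real_of_ereal (K t))"
      using continuous_on_minus by fastforce
    then have "continuous_on {0<..<2*pi} (\<lambda>t. ereal (real_of_ereal (K t)))"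
      by (intro continuous_intros)
    moreover have "ereal (real_of_ereal (K t)) = K t" if "t \<in> {0<..<2*pi}" for t
      using kernel_finite[of t 0] that by (auto simp: branch_def ereal_real)
    ultimately have "continuous_on {0<..<2*pi} K"
      by (metis (mono_tags, lifting) continuous_on_cong)
    then show ?thesis using r by (simp add: continuous_on_eq_continuous_at)
  qed
  define l where "l = \<lfloor>x / (2 * pi)\<rfloor>"
  have "of_int l \<le> x / (2 * pi)" "x / (2 * pi) < of_int l + 1" by (auto simp: l_def)
  then have "isCont K (x - 2 * pi * of_int l)"
    by (intro *) (auto simp: field_simps)
  then have "((\<lambda>t. K (t - 2 * pi * of_int l)) \<longlongrightarrow> K (x - 2 * pi * of_int l)) (at x)"
    by (rule isCont_tendsto_compose) (intro tendsto_intros)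
  then show ?thesis by (simp add: kernel_shift isCont_def)
qed

text \<open>The two ends of the period carry the same value \<open>K 0\<close>. Concavity between
  \<open>e\<close> and \<open>2 * pi - e\<close> passes to the limit as \<open>e\<close> tends to 0,
  where the chord becomes constant.\<close>

lemma kernel_0_le:
  assumes h: "h \<in> {0<..<2*pi}"
  shows "K 0 \<le> K h"
proof (cases "K 0 = -\<infinity>")
  case False
  then have fin: "\<bar>K 0\<bar> \<noteq> \<infinity>" using kernel_not_PInf by auto
  define k where "k t = real_of_ereal (K t)" for t
  \<comment> \<open>With this weight the convex combination of \<open>e\<close> and
    \<open>2 * pi - e\<close> tends to \<open>h\<close>.\<close>
  define u where "u = 1 - h / (2*pi)"
  have u: "0 < u" "u < 1" using h by (auto simp: u_def field_simps)
  have uh: "(1 - u) * (2*pi) = h" by (simp add: u_def)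
  have kr: "(k \<longlongrightarrow> k 0) (at_right 0)" and kl: "(k \<longlongrightarrow> k 0) (at_left (2*pi))"
    unfolding k_def using fin kernel_tendsto_0 by (auto intro!: lim_real_of_ereal)
  have "filterlim (\<lambda>e. 2 * pi - e) (at_left (2*pi)) (at_right 0)"
    unfolding filterlim_at by (auto intro!: tendsto_eq_intros simp: eventually_at_filter)
  then have kl': "((\<lambda>e. k (2 * pi - e)) \<longlongrightarrow> k 0) (at_right 0)"
    using filterlim_compose[OF kl] by blast
  have hb: "h \<in> branch 0" using h by (simp add: branch_def)
  have "isCont (\<lambda>t. real_of_ereal (K t)) h"
    using isCont_kernel[of h] kernel_finite[OF hb] unfolding isCont_def
    by (auto intro!: lim_real_of_ereal)
  then have "((\<lambda>e. k (u * e + (1 - u) * (2*pi - e))) \<longlongrightarrow> k h) (at_right 0)"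
    unfolding k_def by (rule isCont_tendsto_compose) (auto intro!: tendsto_eq_intros simp: uh)
  moreover have "((\<lambda>e. u * k e + (1 - u) * k (2*pi - e)) \<longlongrightarrow> u * k 0 + (1 - u) * k 0) (at_right 0)"
    by (intro tendsto_intros kr kl')
  moreover have "\<forall>\<^sub>F e in at_right 0. u * k e + (1 - u) * k (2*pi - e) \<le> k (u * e + (1 - u) * (2*pi - e))"
  proof -
    have "\<forall>\<^sub>F e in at_right 0. e \<in> {0<..<pi}" by (intro eventually_at_right_real) auto
    then show ?thesis
    proof eventually_elim
      case (elim e)
      then have "e \<in> {0<..<2*pi}" "2*pi - e \<in> {0<..<2*pi}" "e \<noteq> 2*pi - e" by auto
      then show ?case
        using kernel_strictly_concave_0 u unfolding strictly_concave_on_def k_def by fastforce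
    qed
  qed
  ultimately have "u * k 0 + (1 - u) * k 0 \<le> k h"
    by (intro tendsto_le) auto
  then have "k 0 \<le> k h" by (simp add: algebra_simps)
  then show ?thesis using fin kernel_finite[OF hb] unfolding k_def
    by (cases "K 0"; cases "K h") auto
qed auto

text \<open>The limit in \<open>kernel_0_le\<close> loses strictness. It is regained by placing
  \<open>h\<close> strictly between two interior points, whose values are at least
  \<open>K 0\<close>.\<close>

lemma kernel_0_less:
  assumes h: "h \<in> {0<..<2*pi}"
  shows "K 0 < K h"
proof -
  define k where "k t = real_of_ereal (K t)" for t
  \<comment> \<open>The case split keeps \<open>y\<close> both above \<open>h\<close> and below 2
    pi.\<close>
  define x y where "x = h / 2" and "y = h / 2 + (if h < pi then h else pi)"
  have xy: "x \<in> {0<..<2*pi}" "y \<in> {0<..<2*pi}" "x < h" "h < y"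
    using h by (auto simp: x_def y_def)
  define u where "u = (y - h) / (y - x)"
  have u: "0 < u" "u < 1" using xy by (auto simp: u_def field_simps)
  have "u * (y - x) = y - h" using xy by (simp add: u_def)
  then have yu: "u * x + (1 - u) * y = h" by (simp add: algebra_simps)
  have "u * k x + (1 - u) * k y < k (u * x + (1 - u) * y)"
    using kernel_strictly_concave_0 u xy unfolding strictly_concave_on_def k_def by fastforce
  then have 1: "u * k x + (1 - u) * k y < k h" by (simp add: yu)
  have b: "\<bar>K x\<bar> \<noteq> \<infinity>" "\<bar>K y\<bar> \<noteq> \<infinity>" "\<bar>K h\<bar> \<noteq> \<infinity>"
    using kernel_finite[of _ 0] xy h by (auto simp: branch_def)
  show ?thesis
  proof (cases "K 0 = -\<infinity>")
    case True
    then show ?thesis using b by auto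
  next
    case False
    then have fin: "\<bar>K 0\<bar> \<noteq> \<infinity>" using kernel_not_PInf by auto
    have "k 0 \<le> k x" "k 0 \<le> k y"
      unfolding k_def using kernel_0_le[OF xy(1)] kernel_0_le[OF xy(2)] fin b
      by (cases "K 0"; cases "K x"; cases "K y"; simp)+
    then have "u * k 0 + (1 - u) * k 0 \<le> u * k x + (1 - u) * k y"
      using u by (intro add_mono mult_left_mono) auto
    then have "k 0 < k h" using 1 by (simp add: algebra_simps)
    then show ?thesis using fin b unfolding k_def by (cases "K 0"; cases "K h") auto
  qed
qed

text \<open>The base point 0 lies outside the interval of concavity, so chords are drawn from a
  small \<open>e\<close> and then \<open>e\<close> tends to 0.\<close>

lemma kernel_slope_0_mono:
  assumes fin: "K 0 \<noteq> -\<infinity>" and h: "0 < h" "h < h'" "h' < 2*pi"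
  shows "(real_of_ereal (K h') - real_of_ereal (K 0)) / h' \<le> (real_of_ereal (K h) - real_of_ereal (K 0)) / h"
    (is "(?k h' - _) / _ \<le> _")
proof -
  have fin': "\<bar>K 0\<bar> \<noteq> \<infinity>" using kernel_not_PInf fin by auto
  have kr: "(?k \<longlongrightarrow> ?k 0) (at_right 0)"
    using fin' kernel_tendsto_0 by (auto intro!: lim_real_of_ereal)
  have lim: "((\<lambda>e. (?k s - ?k e) / (s - e)) \<longlongrightarrow> (?k s - ?k 0) / (s - 0)) (at_right 0)" if "s \<noteq> 0" for s
    using that by (intro tendsto_intros kr) auto
  have "\<forall>\<^sub>F e in at_right 0. (?k h' - ?k e) / (h' - e) \<le> (?k h - ?k e) / (h - e)"
  proof -
    have "\<forall>\<^sub>F e in at_right 0. e \<in> {0<..<h}" using h by (intro eventually_at_right_real) auto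
    then show ?thesis
    proof eventually_elim
      case (elim e)
      then show ?case
        using strictly_concave_on_slopes(1)[OF kernel_strictly_concave_0, of e h' h] h by auto
    qed
  qed
  then have "(?k h' - ?k 0) / (h' - 0) \<le> (?k h - ?k 0) / (h - 0)"
    by (intro tendsto_le[OF _ lim lim]) (use h in auto)
  then show ?thesis by simp
qed

text \<open>Condition (infinity') concerns derivatives near the lattice, whereas the argument at a
  maximum needs difference quotients based at the lattice point itself. This bound passes from the
  first to the second.\<close>

lemma Dplus_le_kernel_slope_0:
  assumes fin: "K 0 \<noteq> -\<infinity>" and h: "0 < h" "h < 2*pi"
  shows "Dplus (\<lambda>t. real_of_ereal (K t)) h \<le> (real_of_ereal (K h) - real_of_ereal (K 0)) / h"
    (is "Dplus ?k h \<le> _")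
proof -
  have fin': "\<bar>K 0\<bar> \<noteq> \<infinity>" using kernel_not_PInf fin by auto
  have kr: "(?k \<longlongrightarrow> ?k 0) (at_right 0)"
    using fin' kernel_tendsto_0 by (auto intro!: lim_real_of_ereal)
  have "((\<lambda>e. (?k h - ?k e) / (h - e)) \<longlongrightarrow> (?k h - ?k 0) / (h - 0)) (at_right 0)"
    using h by (intro tendsto_intros kr) auto
  moreover have "\<forall>\<^sub>F e in at_right 0. Dplus ?k h \<le> (?k h - ?k e) / (h - e)"
  proof -
    have "\<forall>\<^sub>F e in at_right 0. e \<in> {0<..<h}" using h by (intro eventually_at_right_real) auto
    then show ?thesis
    proof eventually_elim
      case (elim e)
      then show ?case
        using Dplus_lt_slope[OF kernel_strictly_concave_0, of h e] h by auto
    qed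
  qed
  ultimately have "Dplus ?k h \<le> (?k h - ?k 0) / (h - 0)"
    by (intro tendsto_lowerbound) auto
  then show ?thesis by simp
qed

text \<open>The counterpart at the right end of the period, where \<open>K 0\<close> is also the
  limit value.\<close>

lemma kernel_slope_2pi_le_Dplus:
  assumes fin: "K 0 \<noteq> -\<infinity>" and h: "0 < h" "h < 2*pi"
  shows "(real_of_ereal (K 0) - real_of_ereal (K (2*pi - h))) / h \<le> Dplus (\<lambda>t. real_of_ereal (K t)) (2*pi - h)"
    (is "_ \<le> Dplus ?k _")
proof -
  have fin': "\<bar>K 0\<bar> \<noteq> \<infinity>" using kernel_not_PInf fin by auto
  have kl: "(?k \<longlongrightarrow> ?k 0) (at_left (2*pi))"
    using fin' kernel_tendsto_0 by (auto intro!: lim_real_of_ereal)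
  have "((\<lambda>e. (?k e - ?k (2*pi - h)) / (e - (2*pi - h))) \<longlongrightarrow>
      (?k 0 - ?k (2*pi - h)) / (2*pi - (2*pi - h))) (at_left (2*pi))"
    using h by (intro tendsto_intros kl) auto
  moreover have "\<forall>\<^sub>F e in at_left (2*pi). (?k e - ?k (2*pi - h)) / (e - (2*pi - h)) \<le> Dplus ?k (2*pi - h)"
  proof -
    have "\<forall>\<^sub>F e in at_left (2*pi). e \<in> {2*pi - h<..<2*pi}"
      using h by (intro eventually_at_left_real) auto
    then show ?thesis
    proof eventually_elim
      case (elim e)
      then show ?case
        using Dplus_gt_slope[OF kernel_strictly_concave_0, of "2*pi - h" e] h by auto
    qed
  qed
  ultimately have "(?k 0 - ?k (2*pi - h)) / (2*pi - (2*pi - h)) \<le> Dplus ?k (2*pi - h)"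
    by (intro tendsto_upperbound) auto
  then show ?thesis by simp
qed

text \<open>Reduces an infinite slope at the right end of the period to one at the left end.\<close>

lemma kernel_reflect: "strictly_concave_kernel (\<lambda>t. K (- t))"
proof -
  have sc: "strictly_concave_on {0<..<2*pi} (\<lambda>t. real_of_ereal (K (- t)))"
    using strictly_concave_on_reflect[OF kernel_strictly_concave[of "-1", unfolded branch_def]] by simp
  have "K (- t) \<noteq> - \<infinity>" if "t \<in> {0<..<2*pi}" for t
    using kernel_finite[of "-t" "-1"] that by (auto simp: branch_def)
  moreover have "K (- t - 2 * pi) = K (- t)" for t using kernel_shift[of "-t" 1] by simp
  moreover have lim: "((\<lambda>t. K (- t)) \<longlongrightarrow> K (- x)) (at x within A)" for x A
  proof -
    have "((\<lambda>t. - t) \<longlongrightarrow> - x) (at x within A)" by (intro tendsto_intros)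
    then show ?thesis by (rule isCont_tendsto_compose[OF isCont_kernel])
  qed
  moreover have "K (- (2 * pi)) = K 0" using kernel_periodic[of 0 "-1"] by simp
  ultimately have "kernel_base (\<lambda>t. K (- t))"
    unfolding kernel_base_def using kernel_not_PInf lim[of 0 "{0<..}"] lim[of "2*pi" "{..<2*pi}"]
    by simp
  moreover have "concave_on {0<..<2*pi} (\<lambda>t. real_of_ereal (K (- t)))"
    unfolding concave_on_iff
  proof (intro conjI ballI allI impI)
    fix x y u v :: real
    assume *: "x \<in> {0<..<2*pi}" "y \<in> {0<..<2*pi}" "0 \<le> u" "0 \<le> v" "u + v = 1"
    then have v: "v = 1 - u" by simp
    consider "x = y" | "u = 0" | "u = 1" | "x \<noteq> y" "0 < u" "u < 1" using * by linarith
    then show "u * real_of_ereal (K (- x)) + v * real_of_ereal (K (- y)) \<le> real_of_ereal (K (- (u *\<^sub>R x + v *\<^sub>R y)))"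
    proof cases
      case 1
      then show ?thesis by (simp add: v algebra_simps)
    next
      case 4
      then have "real_of_ereal (K (- (u * x + (1 - u) * y))) > u * real_of_ereal (K (- x)) + (1 - u) * real_of_ereal (K (- y))"
        using sc * unfolding strictly_concave_on_def by blast
      then show ?thesis by (simp add: v)
    qed (auto simp: v)
  qed auto
  ultimately show ?thesis using sc by (simp add: strictly_concave_kernel_def concave_kernel_def)
qed

end

section \<open>Maxima of sums of translates\<close>

text \<open>Also \<open>K 0\<close> receives a node \<open>y 0\<close>, so that all
  \<open>n + 1\<close> kernels are treated alike; \<open>Fsum\<close> is the case
  \<open>y 0 = 0\<close>.\<close>

definition translate_sum :: "nat \<Rightarrow> (nat \<Rightarrow> real \<Rightarrow> ereal) \<Rightarrow> (nat \<Rightarrow> real) \<Rightarrow> real \<Rightarrow> ereal" where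
  "translate_sum n K y t = (\<Sum>j\<le>n. K j (t - y j))"

context
  fixes n :: nat and K :: "nat \<Rightarrow> real \<Rightarrow> ereal"
  assumes K: "\<And>j. j \<le> n \<Longrightarrow> strictly_concave_kernel (K j)"
begin

lemma translate_sum_not_PInf: "translate_sum n K y t \<noteq> \<infinity>"
  unfolding translate_sum_def using kernel_not_PInf[OF K] by (auto simp: sum_Pinfty)

lemma translate_sum_real:
  assumes "\<And>j. j \<le> n \<Longrightarrow> \<bar>K j (t - y j)\<bar> \<noteq> \<infinity>"
  shows "translate_sum n K y t = ereal (\<Sum>j\<le>n. real_of_ereal (K j (t - y j)))"
proof -
  have "(\<Sum>j\<le>n. K j (t - y j)) = (\<Sum>j\<le>n. ereal (real_of_ereal (K j (t - y j))))"
    by (rule sum.cong) (use assms in \<open>auto simp: ereal_real\<close>)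
  then show ?thesis by (simp add: translate_sum_def)
qed

text \<open>Plus infinity never occurs as a value, so a summand equal to minus infinity cannot be
  compensated.\<close>

lemma translate_sum_finiteD:
  assumes "translate_sum n K y t \<noteq> -\<infinity>" "j \<le> n"
  shows "\<bar>K j (t - y j)\<bar> \<noteq> \<infinity>"
proof -
  have "K j (t - y j) \<noteq> -\<infinity>"
  proof
    assume "K j (t - y j) = -\<infinity>"
    moreover have "translate_sum n K y t = K j (t - y j) + (\<Sum>i\<in>{..n} - {j}. K i (t - y i))"
      unfolding translate_sum_def using assms(2) by (intro sum.remove) auto
    moreover have "(\<Sum>i\<in>{..n} - {j}. K i (t - y i)) \<noteq> \<infinity>"
      using kernel_not_PInf[OF K] by (auto simp: sum_Pinfty)
    ultimately show False using assms(1) by simp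
  qed
  then show ?thesis using kernel_not_PInf[OF K[OF assms(2)]] by auto
qed

text \<open>Joint continuity in nodes and argument. Addition in \<open>ereal\<close> is continuous
  here because no partial sum is plus infinity.\<close>

lemma translate_sum_tendsto:
  assumes "\<And>j. j \<le> n \<Longrightarrow> ((\<lambda>x. Y x j) \<longlongrightarrow> y j) F" and T: "(T \<longlongrightarrow> t) F"
  shows "((\<lambda>x. translate_sum n K (Y x) (T x)) \<longlongrightarrow> translate_sum n K y t) F"
proof -
  have "((\<lambda>x. \<Sum>j\<in>J. K j (T x - Y x j)) \<longlongrightarrow> (\<Sum>j\<in>J. K j (t - y j))) F" if "finite J" "J \<subseteq> {..n}" for J
    using that
  proof (induction J rule: finite_induct)
    case (insert i J)
    have "((\<lambda>x. T x - Y x i) \<longlongrightarrow> t - y i) F"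
      using assms insert by (intro tendsto_intros) auto
    then have "((\<lambda>x. K i (T x - Y x i)) \<longlongrightarrow> K i (t - y i)) F"
      using insert by (intro isCont_tendsto_compose[OF isCont_kernel[OF K]]) auto
    moreover have "K i (t - y i) \<noteq> \<infinity>" "(\<Sum>j\<in>J. K j (t - y j)) \<noteq> \<infinity>"
      using kernel_not_PInf[OF K] insert by (auto simp: sum_Pinfty)
    ultimately show ?case
      using insert by (auto intro!: tendsto_add_ereal_general)
  qed simp
  then show ?thesis unfolding translate_sum_def by auto
qed

lemma translate_sum_cong_mod:
  assumes "\<And>j. j \<le> n \<Longrightarrow> \<exists>l::int. y' j = y j + 2 * pi * of_int l"
  shows "translate_sum n K y' t = translate_sum n K y t"
  unfolding translate_sum_def
proof (rule sum.cong)
  fix j assume "j \<in> {..n}"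
  then obtain l :: int where "y' j = y j + 2 * pi * of_int l" using assms by auto
  then show "K j (t - y' j) = K j (t - y j)"
    using kernel_shift[OF K, of j "t - y j" l] \<open>j \<in> {..n}\<close> by (simp add: algebra_simps)
qed simp

lemma translate_sum_periodic: "translate_sum n K y (t + 2 * pi * of_int l) = translate_sum n K y t"
  unfolding translate_sum_def
proof (rule sum.cong)
  fix j assume "j \<in> {..n}"
  then show "K j (t + 2 * pi * of_int l - y j) = K j (t - y j)"
    using kernel_periodic[OF K, of j "t - y j" l] by (simp add: algebra_simps)
qed simp

lemma eventually_translate_sum_finite:
  "\<forall>\<^sub>F h in at 0. \<forall>j\<in>{..n}. \<bar>K j (c + h - y j)\<bar> \<noteq> \<infinity>"
proof (rule eventually_ball_finite)
  show "\<forall>j\<in>{..n}. \<forall>\<^sub>F h in at 0. \<bar>K j (c + h - y j)\<bar> \<noteq> \<infinity>"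
  proof
    fix j assume "j \<in> {..n}"
    have "\<forall>\<^sub>F h in at 0. \<exists>l. (c - y j) + h \<in> branch l" by (rule eventually_in_branch)
    then show "\<forall>\<^sub>F h in at 0. \<bar>K j (c + h - y j)\<bar> \<noteq> \<infinity>"
    proof eventually_elim
      case (elim h)
      then show ?case using kernel_finite[OF K[of j], of "c - y j + h"] \<open>j \<in> {..n}\<close>
        by (auto simp: algebra_simps)
    qed
  qed
qed simp

section \<open>Necessary conditions at a maximum point of a sum of translates\<close>

context
  fixes y :: "nat \<Rightarrow> real" and c :: real
  assumes max: "\<And>t. translate_sum n K y t \<le> translate_sum n K y c"
begin

text \<open>Arbitrarily close to \<open>c\<close> there are points off all translated lattices. The
  sum is finite there and bounds the maximum from below.\<close>

lemma max_finite: "translate_sum n K y c \<noteq> -\<infinity>"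
proof -
  have "\<exists>h::real. \<forall>j\<in>{..n}. \<bar>K j (c + h - y j)\<bar> \<noteq> \<infinity>"
    using eventually_happens[OF eventually_translate_sum_finite[of c y]] by auto
  then obtain h where "\<forall>j\<in>{..n}. \<bar>K j (c + h - y j)\<bar> \<noteq> \<infinity>" by blast
  then have "translate_sum n K y (c + h) = ereal (\<Sum>j\<le>n. real_of_ereal (K j (c + h - y j)))"
    by (intro translate_sum_real) auto
  then show ?thesis using max[of "c + h"] by auto
qed

text \<open>\<open>real_of_ereal\<close> sends infinite values to 0, so maximality is stated in real
  numbers only for small nonzero \<open>h\<close>, where all summands are finite.\<close>

lemma max_increments_le:
  "\<forall>\<^sub>F h in at 0. (\<Sum>j\<le>n. real_of_ereal (K j (c - y j + h)) - real_of_ereal (K j (c - y j))) \<le> 0"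
  using eventually_translate_sum_finite[of c y]
proof eventually_elim
  case (elim h)
  then have "translate_sum n K y (c + h) = ereal (\<Sum>j\<le>n. real_of_ereal (K j (c + h - y j)))"
    by (intro translate_sum_real) auto
  moreover have "translate_sum n K y c = ereal (\<Sum>j\<le>n. real_of_ereal (K j (c - y j)))"
    by (intro translate_sum_real translate_sum_finiteD max_finite)
  ultimately have "(\<Sum>j\<le>n. real_of_ereal (K j (c + h - y j))) \<le> (\<Sum>j\<le>n. real_of_ereal (K j (c - y j)))"
    using max[of "c + h"] by simp
  then show ?case by (simp add: sum_subtractf algebra_simps)
qed

lemma max_slopes_le:
  "\<forall>\<^sub>F h in at_right 0. (\<Sum>j\<le>n. (real_of_ereal (K j (c - y j + h)) - real_of_ereal (K j (c - y j))) / h) \<le> 0"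
proof -
  have "\<forall>\<^sub>F h in at_right 0. (\<Sum>j\<le>n. real_of_ereal (K j (c - y j + h)) - real_of_ereal (K j (c - y j))) \<le> 0"
    using max_increments_le by (simp add: eventually_at_split)
  moreover have "\<forall>\<^sub>F h in at_right (0::real). 0 < h" by (simp add: eventually_at_right_less)
  ultimately show ?thesis
    by eventually_elim (simp add: sum_divide_distrib[symmetric] divide_le_0_iff)
qed

text \<open>Adding the increments at \<open>h\<close> and \<open>-h\<close> cancels first-order
  terms, so that only kinks remain visible as \<open>h\<close> tends to 0.\<close>

lemma max_second_differences_le:
  "\<forall>\<^sub>F h in at_right 0. (\<Sum>j\<le>n. (real_of_ereal (K j (c - y j + h)) + real_of_ereal (K j (c - y j - h))
      - 2 * real_of_ereal (K j (c - y j))) / h) \<le> 0"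
proof -
  have r: "\<forall>\<^sub>F h in at_right 0. (\<Sum>j\<le>n. real_of_ereal (K j (c - y j + h)) - real_of_ereal (K j (c - y j))) \<le> 0"
    and l: "\<forall>\<^sub>F h in at_left 0. (\<Sum>j\<le>n. real_of_ereal (K j (c - y j + h)) - real_of_ereal (K j (c - y j))) \<le> 0"
    using max_increments_le by (simp_all add: eventually_at_split)
  have "\<forall>\<^sub>F h in at_right 0. (\<Sum>j\<le>n. real_of_ereal (K j (c - y j - h)) - real_of_ereal (K j (c - y j))) \<le> 0"
    using l unfolding at_left_minus[of "0::real"] eventually_filtermap by simp
  moreover have "\<forall>\<^sub>F h in at_right (0::real). 0 < h" by (simp add: eventually_at_right_less)
  ultimately show ?thesis using r
  proof eventually_elim
    case (elim h)
    then have "(\<Sum>j\<le>n. real_of_ereal (K j (c - y j + h)) + real_of_ereal (K j (c - y j - h))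
      - 2 * real_of_ereal (K j (c - y j))) \<le> 0"
      by (simp add: sum_subtractf sum.distrib sum_distrib_left[symmetric])
    then show ?case using elim by (simp add: sum_divide_distrib[symmetric] divide_le_0_iff)
  qed
qed

text \<open>The right difference quotients of the summand \<open>i\<close> tend to plus infinity
  while those of every other summand are bounded below, so the sum would increase to the right of
  \<open>c\<close>. The value minus infinity of \<open>K i\<close> at 0 is excluded because the
  maximum is finite.\<close>

lemma max_not_at_infinite_slope:
  assumes i: "i \<le> n" "c - y i = 2 * pi * of_int l"
    and inf: "K i 0 \<noteq> -\<infinity> \<Longrightarrow>
      filterlim (\<lambda>h. (real_of_ereal (K i h) - real_of_ereal (K i 0)) / h) at_top (at_right 0)"
  shows False
proof -
  define P where "P j h = (real_of_ereal (K j (c - y j + h)) - real_of_ereal (K j (c - y j))) / h" for j h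
  have "\<exists>C. \<forall>\<^sub>F h in at_right 0. C \<le> P j h" if j: "j \<le> n" for j
  proof (cases "c - y j" rule: branch_cases)
    case (1 l)
    have "\<forall>\<^sub>F h in at_right 0. h \<in> {0<..<2*pi}" by (intro eventually_at_right_real) auto
    \<comment> \<open>At a lattice point the kernel has its strict minimum, so 0 is a lower bound;
      in the other case the quotients converge to the right derivative.\<close>
    then have "\<forall>\<^sub>F h in at_right 0. 0 \<le> P j h"
    proof eventually_elim
      case (elim h)
      have "K j (c - y j + h) = K j h" "K j (c - y j) = K j 0"
        using kernel_periodic[OF K[OF j], of h l] kernel_periodic[OF K[OF j], of 0 l] 1
        by (simp_all add: add.commute)
      moreover have "\<bar>K j h\<bar> \<noteq> \<infinity>" using kernel_finite[OF K[OF j], of h 0] elim by (auto simp: branch_def)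
      moreover have "\<bar>K j (c - y j)\<bar> \<noteq> \<infinity>" by (rule translate_sum_finiteD[OF max_finite j])
      moreover have "K j 0 < K j h" using kernel_0_less[OF K[OF j]] elim by auto
      ultimately have "real_of_ereal (K j (c - y j)) < real_of_ereal (K j (c - y j + h))"
        by (cases "K j 0"; cases "K j h") auto
      then show ?case using elim by (simp add: P_def)
    qed
    then show ?thesis by blast
  next
    case (2 l)
    have "((\<lambda>h. P j h) \<longlongrightarrow> Dplus (\<lambda>t. real_of_ereal (K j t)) (c - y j)) (at_right 0)"
      unfolding P_def using kernel_strictly_concave[OF K[OF j], of l] 2
      unfolding branch_def by (rule Dplus_tendsto)
    then have "\<forall>\<^sub>F h in at_right 0. Dplus (\<lambda>t. real_of_ereal (K j t)) (c - y j) - 1 < P j h"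
      by (rule order_tendstoD) auto
    then have "\<forall>\<^sub>F h in at_right 0. Dplus (\<lambda>t. real_of_ereal (K j t)) (c - y j) - 1 \<le> P j h"
      by eventually_elim simp
    then show ?thesis by blast
  qed
  then obtain C where C: "\<And>j. j \<le> n \<Longrightarrow> \<forall>\<^sub>F h in at_right 0. C j \<le> P j h" by metis
  then have "\<forall>\<^sub>F h in at_right 0. \<forall>j\<in>{..n}. C j \<le> P j h"
    by (intro eventually_ball_finite) auto
  moreover have "K i (c - y i + h) = K i h" "K i (c - y i) = K i 0" for h
    using kernel_periodic[OF K[OF i(1)], of h l] kernel_periodic[OF K[OF i(1)], of 0 l] i
    by (simp_all add: add.commute)
  then have "filterlim (P i) at_top (at_right 0)"
    using inf translate_sum_finiteD[OF max_finite i(1)] unfolding P_def by auto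
  \<comment> \<open>This threshold makes the total of all quotients at least 1.\<close>
  then have "\<forall>\<^sub>F h in at_right 0. 1 - (\<Sum>j\<in>{..n} - {i}. C j) \<le> P i h"
    unfolding filterlim_at_top by blast
  moreover have "\<forall>\<^sub>F h in at_right 0. (\<Sum>j\<le>n. P j h) \<le> 0"
    using max_slopes_le by (simp add: P_def)
  ultimately have "\<forall>\<^sub>F h in at_right (0::real). False"
  proof eventually_elim
    case (elim h)
    have "(\<Sum>j\<in>{..n} - {i}. C j) \<le> (\<Sum>j\<in>{..n} - {i}. P j h)"
      using elim by (intro sum_mono) auto
    moreover have "(\<Sum>j\<le>n. P j h) = P i h + (\<Sum>j\<in>{..n} - {i}. P j h)"
      using i by (intro sum.remove) auto
    ultimately show ?case using elim by linarith
  qed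
  then show False by simp
qed

text \<open>At a lattice point a kernel has a strictly convex kink, which \<open>C\<^sup>1\<close> summands cannot compensate.\<close>
lemma max_not_at_kink:
  assumes i: "i \<le> n" "c - y i = 2 * pi * of_int l"
    and C1: "\<And>j. j \<le> n \<Longrightarrow> C1_kernel (K j)"
  shows False
proof -
  define Q where "Q j h = (real_of_ereal (K j (c - y j + h)) + real_of_ereal (K j (c - y j - h))
      - 2 * real_of_ereal (K j (c - y j))) / h" for j h
  have fin: "\<bar>K j (c - y j)\<bar> \<noteq> \<infinity>" if "j \<le> n" for j
    by (rule translate_sum_finiteD[OF max_finite that])
  have kink: "\<exists>\<eta>>0. \<forall>\<^sub>F h in at_right 0. \<eta> \<le> Q j h"
    if j: "j \<le> n" and l: "c - y j = 2 * pi * of_int l" for j l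
  proof -
    \<comment> \<open>The chord slope from 0 to \<open>pi\<close>. For \<open>h\<close> below
      \<open>pi\<close> it bounds the right half of \<open>Q j h\<close> from below, and the left
      half is nonnegative.\<close>
    define \<eta> where "\<eta> = (real_of_ereal (K j pi) - real_of_ereal (K j 0)) / pi"
    have per: "K j (c - y j + h) = K j h" "K j (c - y j) = K j 0" "K j (c - y j - h) = K j (2 * pi - h)" for h
      using kernel_periodic[OF K[OF j], of h l] kernel_periodic[OF K[OF j], of 0 l]
        kernel_periodic[OF K[OF j], of "2 * pi - h" "l - 1"] l
      by (simp_all add: algebra_simps)
    have fin0: "\<bar>K j 0\<bar> \<noteq> \<infinity>" using fin[OF j] per by simp
    have less: "real_of_ereal (K j 0) < real_of_ereal (K j h)" if "h \<in> {0<..<2*pi}" for h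
      using kernel_0_less[OF K[OF j] that] fin0 kernel_finite[OF K[OF j], of h 0] that
      by (cases "K j 0"; cases "K j h") (auto simp: branch_def)
    have "\<eta> > 0" using less[of pi] by (simp add: \<eta>_def)
    moreover have "\<forall>\<^sub>F h in at_right 0. h \<in> {0<..<pi}" by (intro eventually_at_right_real) auto
    then have "\<forall>\<^sub>F h in at_right 0. \<eta> \<le> Q j h"
    proof eventually_elim
      case (elim h)
      have "\<eta> \<le> (real_of_ereal (K j h) - real_of_ereal (K j 0)) / h"
        unfolding \<eta>_def using elim fin0 by (intro kernel_slope_0_mono[OF K[OF j]]) auto
      moreover have "0 \<le> (real_of_ereal (K j (2 * pi - h)) - real_of_ereal (K j 0)) / h"
        using less[of "2 * pi - h"] elim by simp
      moreover have "Q j h = (real_of_ereal (K j h) - real_of_ereal (K j 0)) / h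
          + (real_of_ereal (K j (2 * pi - h)) - real_of_ereal (K j 0)) / h"
        unfolding Q_def per by (simp add: add_divide_distrib diff_divide_distrib)
      ultimately show ?case by linarith
    qed
    ultimately show ?thesis by blast
  qed
  obtain \<eta> where \<eta>: "\<eta> > 0" "\<forall>\<^sub>F h in at_right 0. \<eta> \<le> Q i h" using kink[OF i] by blast
  \<comment> \<open>Small enough that the other \<open>n\<close> summands together lose less than
    \<eta>.\<close>
  define \<epsilon> where "\<epsilon> = \<eta> / (n + 1)"
  have \<epsilon>: "\<epsilon> > 0" using \<eta> by (simp add: \<epsilon>_def)
  have "\<forall>\<^sub>F h in at_right 0. - \<epsilon> \<le> Q j h" if j: "j \<le> n" for j
  proof (cases "c - y j" rule: branch_cases)
    case (1 l)
    then obtain \<eta>' where "\<eta>' > 0" "\<forall>\<^sub>F h in at_right 0. \<eta>' \<le> Q j h" using kink[OF j] by blast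
    then show ?thesis using \<epsilon> by (auto elim!: eventually_mono)
  next
    case (2 l)
    let ?k = "\<lambda>t. real_of_ereal (K j t)"
    obtain D where "(?k has_real_derivative D) (at (c - y j - 2 * pi * of_int l))"
      using C1[OF j] 2 unfolding C1_kernel_def branch_shift_iff by blast
    then have "((\<lambda>t. ?k (t - 2 * pi * of_int l)) has_real_derivative D * (1 - 0)) (at (c - y j))"
      by (rule DERIV_chain2[where g = "\<lambda>t. t - 2 * pi * of_int l"]) (intro derivative_intros)
    then have D: "((\<lambda>h. (?k (c - y j + h) - ?k (c - y j)) / h) \<longlongrightarrow> D) (at 0)"
      by (simp add: kernel_shift[OF K[OF j]] DERIV_def)
    have r: "((\<lambda>h. (?k (c - y j + h) - ?k (c - y j)) / h) \<longlongrightarrow> D) (at_right 0)"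
      and l: "((\<lambda>h. (?k (c - y j + h) - ?k (c - y j)) / h) \<longlongrightarrow> D) (at_left 0)"
      using D by (simp_all add: filterlim_at_split)
    have "((\<lambda>h. (?k (c - y j - h) - ?k (c - y j)) / (- h)) \<longlongrightarrow> D) (at_right 0)"
      using l unfolding at_left_minus[of "0::real"] filterlim_filtermap by simp
    \<comment> \<open>The right and left difference quotients have the common limit
      \<open>D\<close>, so the second difference quotient vanishes in the limit.\<close>
    from tendsto_diff[OF r this] have "(Q j \<longlongrightarrow> 0) (at_right 0)"
      unfolding Q_def by (simp add: add_divide_distrib diff_divide_distrib)
    then have "\<forall>\<^sub>F h in at_right 0. - \<epsilon> < Q j h" using \<epsilon> by (intro order_tendstoD) auto
    then show ?thesis by (auto elim!: eventually_mono)
  qed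
  then have "\<forall>\<^sub>F h in at_right 0. \<forall>j\<in>{..n}. - \<epsilon> \<le> Q j h"
    by (intro eventually_ball_finite) auto
  moreover have "\<forall>\<^sub>F h in at_right 0. (\<Sum>j\<le>n. Q j h) \<le> 0"
    using max_second_differences_le by (simp add: Q_def)
  ultimately have "\<forall>\<^sub>F h in at_right (0::real). False" using \<eta>(2)
  proof eventually_elim
    case (elim h)
    have "(\<Sum>j\<in>{..n} - {i}. - \<epsilon>) \<le> (\<Sum>j\<in>{..n} - {i}. Q j h)"
      using elim by (intro sum_mono) auto
    then have "- (n * \<epsilon>) \<le> (\<Sum>j\<in>{..n} - {i}. Q j h)" using i by simp
    moreover have "(\<Sum>j\<le>n. Q j h) = Q i h + (\<Sum>j\<in>{..n} - {i}. Q j h)"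
      using i by (intro sum.remove) auto
    moreover have "n * \<epsilon> < \<eta>" using \<eta>(1) by (simp add: \<epsilon>_def field_simps)
    ultimately show ?case using elim by linarith
  qed
  then show False by simp
qed

text \<open>The \<open>a j\<close> give a supergradient of \<open>(y, t) \<mapsto> translate_sum n K y t\<close>. Each lies between the right
  and the left derivative of its kernel, and they sum to zero, which is why \<open>t' - c\<close> does not appear.\<close>
lemma max_tangent:
  assumes l: "\<And>j. j \<le> n \<Longrightarrow> c - y j \<in> branch (l j)"
  shows "\<exists>a. \<forall>y' t'. (\<forall>j\<le>n. t' - y' j \<in> branch (l j)) \<longrightarrow> (\<exists>j\<le>n. t' - y' j \<noteq> c - y j) \<longrightarrow>
      translate_sum n K y' t' < translate_sum n K y c + ereal (\<Sum>j\<le>n. a j * (y j - y' j))"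
proof -
  let ?k = "\<lambda>j t. real_of_ereal (K j t)"
  \<comment> \<open>The right and the left derivatives of the summands; maximality makes the first
    sum nonpositive and the second nonnegative.\<close>
  define R L where "R j = Dplus (?k j) (c - y j)"
    and "L j = - Dplus (\<lambda>t. ?k j (- t)) (- (c - y j))" for j
  note sc = kernel_strictly_concave[OF K, unfolded branch_def]
  have Rlim: "((\<lambda>h. (?k j (c - y j + h) - ?k j (c - y j)) / h) \<longlongrightarrow> R j) (at_right 0)" if "j \<le> n" for j
    unfolding R_def using Dplus_tendsto[OF sc[OF that, of "l j"]] l[OF that] by (simp add: branch_def)
  have "(\<Sum>j\<le>n. R j) \<le> 0"
    by (rule tendsto_upperbound[OF tendsto_sum max_slopes_le]) (use Rlim in auto)
  have Llim: "((\<lambda>h. (?k j (- (- (c - y j) + h)) - ?k j (- (- (c - y j)))) / h) \<longlongrightarrow> - L j) (at_right 0)"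
    if "j \<le> n" for j
    using Dplus_tendsto[OF strictly_concave_on_reflect[OF sc[OF that, of "l j"]], of "- (c - y j)"] l[OF that]
    unfolding L_def branch_def by auto
  have "\<forall>\<^sub>F h in at_left 0. (\<Sum>j\<le>n. ?k j (c - y j + h) - ?k j (c - y j)) \<le> 0"
    using max_increments_le by (simp add: eventually_at_split)
  then have "\<forall>\<^sub>F h in at_right 0. (\<Sum>j\<le>n. ?k j (c - y j - h) - ?k j (c - y j)) \<le> 0"
    unfolding at_left_minus[of "0::real"] eventually_filtermap by simp
  moreover have "\<forall>\<^sub>F h in at_right (0::real). 0 < h" by (simp add: eventually_at_right_less)
  ultimately have left: "\<forall>\<^sub>F h in at_right 0. (\<Sum>j\<le>n. (?k j (- (- (c - y j) + h)) - ?k j (- (- (c - y j)))) / h) \<le> 0"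
    by eventually_elim (simp add: sum_divide_distrib[symmetric] divide_le_0_iff)
  have "(\<Sum>j\<le>n. - L j) \<le> 0"
    by (rule tendsto_upperbound[OF tendsto_sum left]) (use Llim in auto)
  then have "0 \<le> (\<Sum>j\<le>n. L j)" by (simp add: sum_negf)
  have RL: "R j \<le> L j" if "j \<le> n" for j
    unfolding R_def L_def using Dplus_le_left_derivative[OF sc[OF that, of "l j"], of "c - y j"] l[OF that]
    by (simp add: branch_def)
  \<comment> \<open>Zero lies between the two sums, so one common mixture of right and left
    derivatives sums to zero.\<close>
  obtain \<theta> where \<theta>: "0 \<le> \<theta>" "\<theta> \<le> 1" "\<theta> * (\<Sum>j\<le>n. R j) + (1 - \<theta>) * (\<Sum>j\<le>n. L j) = 0"
  proof (cases "(\<Sum>j\<le>n. L j) = (\<Sum>j\<le>n. R j)")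
    case True
    then show ?thesis using that[of 0] \<open>(\<Sum>j\<le>n. R j) \<le> 0\<close> \<open>0 \<le> (\<Sum>j\<le>n. L j)\<close> by simp
  next
    case False
    define \<theta> where "\<theta> = (\<Sum>j\<le>n. L j) / ((\<Sum>j\<le>n. L j) - (\<Sum>j\<le>n. R j))"
    have "(\<Sum>j\<le>n. L j) - (\<Sum>j\<le>n. R j) > 0"
      using False \<open>(\<Sum>j\<le>n. R j) \<le> 0\<close> \<open>0 \<le> (\<Sum>j\<le>n. L j)\<close> by linarith
    then have "0 \<le> \<theta>" "\<theta> \<le> 1" "\<theta> * ((\<Sum>j\<le>n. L j) - (\<Sum>j\<le>n. R j)) = (\<Sum>j\<le>n. L j)"
      using \<open>(\<Sum>j\<le>n. R j) \<le> 0\<close> \<open>0 \<le> (\<Sum>j\<le>n. L j)\<close> by (auto simp: \<theta>_def)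
    then show ?thesis using that[of \<theta>] by (simp add: algebra_simps)
  qed
  define a where "a j = \<theta> * R j + (1 - \<theta>) * L j" for j
  have a0: "(\<Sum>j\<le>n. a j) = 0"
    using \<theta>(3) by (simp add: a_def sum.distrib sum_distrib_left)
  have aRL: "R j \<le> a j" "a j \<le> L j" if "j \<le> n" for j
  proof -
    have "(1 - \<theta>) * R j \<le> (1 - \<theta>) * L j" "\<theta> * R j \<le> \<theta> * L j"
      using RL[OF that] \<theta> by (auto intro: mult_left_mono)
    then show "R j \<le> a j" "a j \<le> L j" by (auto simp: a_def algebra_simps)
  qed
  show ?thesis
  proof (intro exI[of _ a] allI impI)
    fix y' t'
    assume "\<forall>j\<le>n. t' - y' j \<in> branch (l j)"
    then have b: "\<And>j. j \<le> n \<Longrightarrow> t' - y' j \<in> branch (l j)" by blast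
    assume ne: "\<exists>j\<le>n. t' - y' j \<noteq> c - y j"
    have strict: "?k j (t' - y' j) < ?k j (c - y j) + a j * ((t' - y' j) - (c - y j))"
      if "j \<le> n" "t' - y' j \<noteq> c - y j" for j
      using strictly_concave_on_tangent[OF sc[OF that(1), of "l j"], of "c - y j" "t' - y' j" "a j"]
        b[OF that(1)] l[OF that(1)] that aRL[OF that(1)]
      by (simp add: branch_def R_def L_def)
    \<comment> \<open>A summand whose argument does not change gives equality; a single changed
      argument makes the whole sum strict.\<close>
    then have weak: "?k j (t' - y' j) \<le> ?k j (c - y j) + a j * ((t' - y' j) - (c - y j))"
      if "j \<le> n" for j
      using that by (cases "t' - y' j = c - y j") (auto simp: less_imp_le)
    have "(\<Sum>j\<le>n. ?k j (t' - y' j)) < (\<Sum>j\<le>n. ?k j (c - y j) + a j * ((t' - y' j) - (c - y j)))"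
      using ne strict weak by (intro sum_strict_mono_ex1) auto
    also have "\<dots> = (\<Sum>j\<le>n. ?k j (c - y j)) + (\<Sum>j\<le>n. a j * (t' - c)) + (\<Sum>j\<le>n. a j * (y j - y' j))"
      by (simp add: sum.distrib[symmetric] algebra_simps)
    also have "(\<Sum>j\<le>n. a j * (t' - c)) = 0"
      using a0 by (simp add: sum_distrib_right[symmetric])
    finally have "(\<Sum>j\<le>n. ?k j (t' - y' j)) < (\<Sum>j\<le>n. ?k j (c - y j)) + (\<Sum>j\<le>n. a j * (y j - y' j))"
      by simp
    moreover have "translate_sum n K y' t' = ereal (\<Sum>j\<le>n. ?k j (t' - y' j))"
      by (intro translate_sum_real kernel_finite[OF K b])
    moreover have "translate_sum n K y c = ereal (\<Sum>j\<le>n. ?k j (c - y j))"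
      by (intro translate_sum_real kernel_finite[OF K l])
    ultimately show "translate_sum n K y' t' < translate_sum n K y c + ereal (\<Sum>j\<le>n. a j * (y j - y' j))"
      by simp
  qed
qed

end

end

text \<open>The \<open>C1_kernel\<close> case is the kink argument. Under (infinity') the slope of
  \<open>K i\<close> is infinite at one end of the period, and the right end is reflected to the
  left one.\<close>

lemma max_not_at_node:
  assumes K: "\<And>j. j \<le> n \<Longrightarrow> strictly_concave_kernel (K j)"
    and smooth: "(\<forall>j\<le>n. cond_infty' (K j)) \<or> (\<forall>j\<le>n. C1_kernel (K j))"
    and max: "\<And>t. translate_sum n K y t \<le> translate_sum n K y c"
    and i: "i \<le> n" "c - y i = 2 * pi * of_int l"
  shows False
  using smooth
proof
  assume "\<forall>j\<le>n. C1_kernel (K j)"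
  then show False using max_not_at_kink[where K = K, OF K max i] by blast
next
  let ?k = "\<lambda>t. real_of_ereal (K i t)"
  assume "\<forall>j\<le>n. cond_infty' (K j)"
  then consider "filterlim (Dplus ?k) at_bot (at_left (2*pi))" | "filterlim (Dplus ?k) at_top (at_right 0)"
    using i by (auto simp: cond_infty'_def Let_def)
  then show False
  proof cases
    case 2
    show False
    proof (rule max_not_at_infinite_slope[where K = K, OF K max i])
      assume fin: "K i 0 \<noteq> -\<infinity>"
      have "\<forall>\<^sub>F h in at_right 0. h \<in> {0<..<2*pi}" by (intro eventually_at_right_real) auto
      then have "\<forall>\<^sub>F h in at_right 0. Dplus ?k h \<le> (?k h - ?k 0) / h"
        by eventually_elim (use Dplus_le_kernel_slope_0[OF K[OF i(1)] fin] in auto)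
      then show "filterlim (\<lambda>h. (?k h - ?k 0) / h) at_top (at_right 0)"
        by (rule filterlim_at_top_mono[OF 2])
    qed
  next
    case 1
    \<comment> \<open>Reflecting kernels, nodes and maximum point together leaves the values of the
      sum unchanged.\<close>
    define K' where "K' j t = K j (- t)" for j t
    have K': "strictly_concave_kernel (K' j)" if "j \<le> n" for j
      unfolding K'_def using kernel_reflect[OF K[OF that]] .
    have ts: "translate_sum n K' (\<lambda>j. - y j) t = translate_sum n K y (- t)" for t
      by (simp add: translate_sum_def K'_def algebra_simps)
    have max': "translate_sum n K' (\<lambda>j. - y j) t \<le> translate_sum n K' (\<lambda>j. - y j) (- c)" for t
      unfolding ts using max by simp
    have l': "- c - - y i = 2 * pi * of_int (- l)" using i by simp
    show False
    proof (rule max_not_at_infinite_slope[where K = K', OF K' max' i(1) l'])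
      assume "K' i 0 \<noteq> -\<infinity>"
      then have fin: "K i 0 \<noteq> -\<infinity>" by (simp add: K'_def)
      have "filterlim (\<lambda>h. 2 * pi - h) (at_left (2*pi)) (at_right 0)"
        unfolding filterlim_at by (auto intro!: tendsto_eq_intros simp: eventually_at_filter)
      from filterlim_compose[OF 1 this]
      have D: "filterlim (\<lambda>h. - Dplus ?k (2 * pi - h)) at_top (at_right 0)"
        by (simp add: filterlim_uminus_at_top)
      have "\<forall>\<^sub>F h in at_right 0. h \<in> {0<..<2*pi}" by (intro eventually_at_right_real) auto
      then have "\<forall>\<^sub>F h in at_right 0. - Dplus ?k (2 * pi - h)
          \<le> (real_of_ereal (K' i h) - real_of_ereal (K' i 0)) / h"
      proof eventually_elim
        case (elim h)
        have "K' i h = K i (2 * pi - h)"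
          using kernel_periodic[OF K[OF i(1)], of "- h" 1] by (simp add: K'_def algebra_simps)
        moreover have "(?k (2 * pi - h) - ?k 0) / h = - ((?k 0 - ?k (2 * pi - h)) / h)"
          by (simp add: minus_divide_left)
        ultimately show ?case
          using kernel_slope_2pi_le_Dplus[OF K[OF i(1)] fin, of h] elim by (simp add: K'_def)
      qed
      then show "filterlim (\<lambda>h. (real_of_ereal (K' i h) - real_of_ereal (K' i 0)) / h) at_top (at_right 0)"
        by (rule filterlim_at_top_mono[OF D])
    qed
  qed
qed

section \<open>Perturbing the nodes\<close>

text \<open>Compactness of a finite-dimensional cube: the subsequence is thinned out once for each
  coordinate.\<close>

lemma simultaneous_convergent_subsequence:
  fixes Y :: "nat \<Rightarrow> 'k \<Rightarrow> real"
  assumes "finite J" "\<And>m j. j \<in> J \<Longrightarrow> Y m j \<in> {a..b}"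
  shows "\<exists>r y. strict_mono r \<and> (\<forall>j\<in>J. y j \<in> {a..b} \<and> (\<lambda>m. Y (r m) j) \<longlonglongrightarrow> y j)"
  using assms
proof (induction J rule: finite_induct)
  case empty
  then show ?case by (intro exI[of _ id]) (auto simp: strict_mono_def)
next
  case (insert i J)
  then obtain r y where r: "strict_mono r" "\<forall>j\<in>J. y j \<in> {a..b} \<and> (\<lambda>m. Y (r m) j) \<longlonglongrightarrow> y j"
    by auto
  have "\<forall>m. Y (r m) i \<in> {a..b}" using insert by auto
  then obtain x q where q: "x \<in> {a..b}" "strict_mono q" "((\<lambda>m. Y (r m) i) \<circ> q) \<longlonglongrightarrow> x"
    using compact_Icc[of a b] unfolding compact_def by metis
  have "(\<lambda>m. Y ((r \<circ> q) m) j) \<longlonglongrightarrow> y j" if "j \<in> J" for j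
    using LIMSEQ_subseq_LIMSEQ[OF _ q(2), of "\<lambda>m. Y (r m) j" "y j"] r(2) that by (auto simp: o_def)
  moreover have "strict_mono (r \<circ> q)" using r q by (simp add: strict_mono_o)
  ultimately show ?case using insert.hyps q r
    by (intro exI[of _ "r \<circ> q"] exI[of _ "y(i := x)"]) (auto simp: o_def)
qed

lemma Fsum_eq_translate_sum: "Fsum n K y t = translate_sum n K (y(0 := 0)) t"
proof -
  have "{..n} = insert 0 {1..n}" by auto
  then have "translate_sum n K (y(0 := 0)) t = K 0 t + (\<Sum>j\<in>{1..n}. K j (t - (y(0 := 0)) j))"
    by (simp add: translate_sum_def)
  also have "(\<Sum>j\<in>{1..n}. K j (t - (y(0 := 0)) j)) = (\<Sum>j\<in>{1..n}. K j (t - y j))"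
    by (rule sum.cong) auto
  finally show ?thesis unfolding Fsum_def ..
qed

lemma reduce_mod_2pi:
  obtains l :: int where "x - 2 * pi * of_int l \<in> {0..<2*pi}"
proof -
  define l where "l = \<lfloor>x / (2 * pi)\<rfloor>"
  have "of_int l \<le> x / (2 * pi)" "x / (2 * pi) < of_int l + 1" by (auto simp: l_def)
  then have "x - 2 * pi * of_int l \<in> {0..<2*pi}" by (auto simp: field_simps)
  then show ?thesis by (rule that)
qed

lemma sorting_permutation:
  fixes w :: "nat \<Rightarrow> real"
  assumes "inj_on w {1..n}"
  shows "\<exists>\<sigma>. \<sigma> permutes {1..n} \<and> (\<forall>i j. 1 \<le> i \<and> i < j \<and> j \<le> n \<longrightarrow> w (\<sigma> i) < w (\<sigma> j))"
proof -
  \<comment> \<open>The indices are sorted by their values under \<open>w\<close>. List positions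
    start at 0, hence the shift by one in \<sigma>.\<close>
  define xs where "xs = sort_key w [1..<n + 1]"
  have xs: "set xs = {1..n}" "distinct xs" "length xs = n" "sorted (map w xs)"
    by (auto simp: xs_def)
  define \<sigma> where "\<sigma> k = (if k \<in> {1..n} then xs ! (k - 1) else k)" for k
  have in_xs: "\<sigma> k \<in> {1..n}" if "k \<in> {1..n}" for k
    using xs that nth_mem[of "k - 1" xs] by (auto simp: \<sigma>_def)
  have "inj_on \<sigma> {1..n}"
    unfolding inj_on_def \<sigma>_def using xs by (auto simp: nth_eq_iff_index_eq)
  then have "bij_betw \<sigma> {1..n} {1..n}"
    using in_xs endo_inj_surj[of "{1..n}" \<sigma>] by (auto simp: bij_betw_def image_subset_iff)
  then have "\<sigma> permutes {1..n}"
    by (rule bij_imp_permutes) (auto simp: \<sigma>_def)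
  moreover have "w (\<sigma> i) < w (\<sigma> j)" if "1 \<le> i" "i < j" "j \<le> n" for i j
  proof -
    have "w (\<sigma> i) \<le> w (\<sigma> j)"
      using sorted_nth_mono[OF xs(4), of "i - 1" "j - 1"] xs(3) that by (auto simp: \<sigma>_def)
    moreover have "\<sigma> i \<noteq> \<sigma> j" using inj_on_eq_iff[OF \<open>inj_on \<sigma> {1..n}\<close>, of i j] that by auto
    then have "w (\<sigma> i) \<noteq> w (\<sigma> j)" using inj_on_eq_iff[OF assms, of "\<sigma> i" "\<sigma> j"] in_xs[of i] in_xs[of j] that by auto
    ultimately show ?thesis by simp
  qed
  ultimately show ?thesis by blast
qed

lemma SUP_greater_interior:
  fixes F :: "real \<Rightarrow> ereal"
  assumes F: "continuous_on UNIV F" and ab: "a < b" and C: "C < (SUP t\<in>{a..b}. F t)"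
  obtains t where "t \<in> {a<..<b}" "C < F t"
proof -
  obtain s where s: "s \<in> {a..b}" "C < F s" using C by (auto simp: less_SUP_iff)
  have "open {t. C < F t}" using F by (intro open_Collect_less continuous_on_const)
  moreover have "s \<in> closure {a<..<b}" using s ab by simp
  ultimately obtain t where "t \<in> {a<..<b}" "t \<in> {t. C < F t}"
    using s open_Int_closure_eq_empty[of "{t. C < F t}" "{a<..<b}"] by blast
  then show ?thesis using that by blast
qed

text \<open>Each argument \<open>t - y j\<close> is linear in nodes and \<open>t\<close> jointly,
  and stays in its convex branch, so concavity can be added up over the kernels.\<close>

lemma translate_sum_concave:
  assumes K: "\<And>j. j \<le> n \<Longrightarrow> strictly_concave_kernel (K j)"
    and b: "\<And>j. j \<le> n \<Longrightarrow> t - y j \<in> branch (l j)" "\<And>j. j \<le> n \<Longrightarrow> t' - y' j \<in> branch (l j)"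
    and u: "0 < u" "u < 1"
    and ab: "translate_sum n K y t = ereal a" "translate_sum n K y' t' = ereal b"
  shows "ereal (u * a + (1 - u) * b) \<le> translate_sum n K (\<lambda>j. u * y j + (1 - u) * y' j) (u * t + (1 - u) * t')"
proof -
  let ?k = "\<lambda>j t. real_of_ereal (K j t)"
  have eq: "u * t + (1 - u) * t' - (u * y j + (1 - u) * y' j) = u * (t - y j) + (1 - u) * (t' - y' j)" for j
    by (simp add: algebra_simps)
  have mid: "u * (t - y j) + (1 - u) * (t' - y' j) \<in> branch (l j)" if "j \<le> n" for j
  proof -
    have "convex (branch (l j))" by (simp add: branch_def)
    from convexD[OF this b(1)[OF that] b(2)[OF that], of u "1 - u"] show ?thesis using u by simp
  qed
  have "u * ?k j (t - y j) + (1 - u) * ?k j (t' - y' j) \<le> ?k j (u * (t - y j) + (1 - u) * (t' - y' j))"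
    if "j \<le> n" for j
  proof (cases "t - y j = t' - y' j")
    case True
    have "u * q + (1 - u) * q = q" for q :: real by (simp add: algebra_simps)
    then show ?thesis unfolding True by simp
  next
    case False
    then show ?thesis
      using kernel_strictly_concave[OF K[OF that], of "l j"] b[OF that] u
      unfolding strictly_concave_on_def by (meson less_imp_le)
  qed
  then have "(\<Sum>j\<le>n. u * ?k j (t - y j) + (1 - u) * ?k j (t' - y' j))
      \<le> (\<Sum>j\<le>n. ?k j (u * (t - y j) + (1 - u) * (t' - y' j)))"
    by (intro sum_mono) auto
  moreover have "a = (\<Sum>j\<le>n. ?k j (t - y j))"
    using ab(1) translate_sum_real[where K = K, OF K kernel_finite[OF K b(1)]] by simp
  moreover have "b = (\<Sum>j\<le>n. ?k j (t' - y' j))"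
    using ab(2) translate_sum_real[where K = K, OF K kernel_finite[OF K b(2)]] by simp
  moreover have "\<bar>K j (u * t + (1 - u) * t' - (u * y j + (1 - u) * y' j))\<bar> \<noteq> \<infinity>" if "j \<le> n" for j
    unfolding eq by (rule kernel_finite[OF K[OF that] mid[OF that]])
  then have "translate_sum n K (\<lambda>j. u * y j + (1 - u) * y' j) (u * t + (1 - u) * t')
      = ereal (\<Sum>j\<le>n. ?k j (u * (t - y j) + (1 - u) * (t' - y' j)))"
    by (subst translate_sum_real[where K = K, OF K]) (simp_all add: eq)
  ultimately show ?thesis
    by (simp add: sum.distrib sum_distrib_left)
qed

section \<open>Lowering the maximum when there are few maximum points\<close>

context
  fixes n :: nat and K :: "nat \<Rightarrow> real \<Rightarrow> ereal"
  assumes n: "n \<ge> 1"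
    and K: "\<And>j. j \<le> n \<Longrightarrow> strictly_concave_kernel (K j)"
    and smooth: "(\<forall>j\<le>n. cond_infty' (K j)) \<or> (\<forall>j\<le>n. C1_kernel (K j))"
begin

lemma max_point_in_branches:
  assumes max: "\<And>t. translate_sum n K w t \<le> translate_sum n K w z" and j: "j \<le> n"
  shows "\<exists>l. z - w j \<in> branch l"
proof (cases "z - w j" rule: branch_cases)
  case (1 l)
  then show ?thesis using max_not_at_node[where K = K, OF K smooth max j] by blast
qed auto

text \<open>Each point of \<open>Z\<close> imposes one linear inequality on the direction of motion,
  hence at most \<open>n\<close> inequalities for \<open>n\<close> movable nodes. Along a nonzero
  solution no tangent bound exceeds \<open>M\<close>, and strict concavity makes the values smaller
  still. Compactness excludes maximum points far from \<open>Z\<close> for small steps.\<close>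

lemma improving_perturbation:
  assumes M: "\<And>t. translate_sum n K w t \<le> M"
    and Z: "Z = {t \<in> {0..<2*pi}. translate_sum n K w t = M}" "finite Z" "card Z \<le> n"
  obtains y where "y 0 = w 0" "\<And>t. translate_sum n K y t < M"
proof -
  have max: "translate_sum n K w t \<le> translate_sum n K w z" if "z \<in> Z" for z t
    using M that by (simp add: Z)
  have "\<forall>z\<in>Z. \<exists>l. \<forall>j\<le>n. z - w j \<in> branch (l j)"
    using max_point_in_branches[OF max] by metis
  then obtain l where l: "\<And>z j. z \<in> Z \<Longrightarrow> j \<le> n \<Longrightarrow> z - w j \<in> branch (l z j)" by metis
  define tangent where "tangent z a \<longleftrightarrow> (\<forall>y' t'. (\<forall>j\<le>n. t' - y' j \<in> branch (l z j)) \<longrightarrow>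
      (\<exists>j\<le>n. t' - y' j \<noteq> z - w j) \<longrightarrow>
      translate_sum n K y' t' < M + ereal (\<Sum>j\<le>n. a j * (w j - y' j)))" for z a
  have "\<forall>z\<in>Z. \<exists>a. tangent z a"
  proof
    fix z assume z: "z \<in> Z"
    then have "translate_sum n K w z = M" by (simp add: Z)
    then show "\<exists>a. tangent z a"
      using max_tangent[where K = K and l = "l z", OF K max[OF z] l[OF z]] unfolding tangent_def by simp
  qed
  then obtain a where "\<And>z. z \<in> Z \<Longrightarrow> tangent z (a z)" by metis
  then have a: "\<And>z y' t'. z \<in> Z \<Longrightarrow> (\<And>j. j \<le> n \<Longrightarrow> t' - y' j \<in> branch (l z j)) \<Longrightarrow>
      (\<exists>j\<le>n. t' - y' j \<noteq> z - w j) \<Longrightarrow>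
      translate_sum n K y' t' < M + ereal (\<Sum>j\<le>n. a z j * (w j - y' j))"
    unfolding tangent_def by simp
  obtain v where v: "\<exists>k\<in>{1..n}. v k \<noteq> 0" "\<forall>z\<in>Z. (\<Sum>k\<in>{1..n}. a z k * v k) \<ge> 0"
    using homogeneous_inequalities_solution[of Z "{1..n}" a] Z n by auto
  \<comment> \<open>The node with index 0 stays fixed.\<close>
  define v0 where "v0 = v(0 := 0)"
  have v0: "0 \<le> (\<Sum>j\<le>n. a z j * v0 j)" if "z \<in> Z" for z
  proof -
    have "{..n} = insert 0 {1..n}" by auto
    then have "(\<Sum>j\<le>n. a z j * v0 j) = (\<Sum>j\<in>{1..n}. a z j * v0 j)" by (simp add: v0_def)
    also have "\<dots> = (\<Sum>j\<in>{1..n}. a z j * v j)" by (rule sum.cong) (auto simp: v0_def)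
    finally show ?thesis using v(2) that by simp
  qed
  \<comment> \<open>Steps of length \<open>1 / (m + 1)\<close> along the direction; a sufficiently
    late one will do.\<close>
  define Y where "Y m j = w j + v0 j * inverse (real (Suc m))" for m j
  have Y0: "Y m 0 = w 0" for m by (simp add: Y_def v0_def)
  have Ylim: "(\<lambda>m. Y m j) \<longlonglongrightarrow> w j" for j
  proof -
    have "(\<lambda>m. w j + v0 j * inverse (real (Suc m))) \<longlonglongrightarrow> w j + v0 j * 0"
      by (intro tendsto_intros LIMSEQ_inverse_real_of_nat)
    then show ?thesis by (simp add: Y_def)
  qed
  have "\<exists>m. \<forall>t. translate_sum n K (Y m) t < M"
  proof (rule ccontr)
    assume neg: "\<not> ?thesis"
    have "\<forall>m. \<exists>t. t \<in> {0..2*pi} \<and> M \<le> translate_sum n K (Y m) t"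
    proof
      fix m
      obtain t where t: "M \<le> translate_sum n K (Y m) t" using neg by (meson not_le)
      obtain e :: int where e: "t - 2 * pi * of_int e \<in> {0..<2*pi}" by (rule reduce_mod_2pi)
      have "translate_sum n K (Y m) (t - 2 * pi * of_int e) = translate_sum n K (Y m) t"
        using translate_sum_periodic[where K = K, OF K, of n "Y m" t "- e"] by simp
      then show "\<exists>t. t \<in> {0..2*pi} \<and> M \<le> translate_sum n K (Y m) t"
        using t e by (intro exI[of _ "t - 2 * pi * of_int e"]) auto
    qed
    then obtain T where T: "\<And>m. T m \<in> {0..2*pi}" "\<And>m. M \<le> translate_sum n K (Y m) (T m)" by metis
    obtain t r where r: "strict_mono r" "(T \<circ> r) \<longlonglongrightarrow> t"
      using compact_Icc[of 0 "2*pi"] T(1) unfolding compact_def by metis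
    have Yr: "(\<lambda>m. Y (r m) j) \<longlonglongrightarrow> w j" for j
      using LIMSEQ_subseq_LIMSEQ[OF Ylim[of j] r(1)] by (simp add: o_def)
    have Tr: "(\<lambda>m. T (r m)) \<longlonglongrightarrow> t" using r(2) by (simp add: o_def)
    have "(\<lambda>m. translate_sum n K (Y (r m)) (T (r m))) \<longlonglongrightarrow> translate_sum n K w t"
      by (rule translate_sum_tendsto[where K = K, OF K Yr Tr])
    \<comment> \<open>The points where the perturbed sums reach \<open>M\<close> accumulate at a
      maximum point of the unperturbed sum, which reduces modulo 2 pi to an element of
      \<open>Z\<close>.\<close>
    then have "M \<le> translate_sum n K w t"
      by (rule LIMSEQ_le_const) (use T in auto)
    then have Mt: "translate_sum n K w t = M" using M by (simp add: antisym)
    obtain e :: int where e: "t - 2 * pi * of_int e \<in> {0..<2*pi}" by (rule reduce_mod_2pi)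
    define z where "z = t - 2 * pi * of_int e"
    have z: "z \<in> Z"
      using e Mt translate_sum_periodic[where K = K, OF K, of n w t "- e"] by (simp add: Z z_def)
    have lim: "(\<lambda>m. (T (r m) - 2 * pi * of_int e) - Y (r m) j) \<longlonglongrightarrow> z - w j" for j
      unfolding z_def by (intro tendsto_intros Tr Yr)
    have "\<forall>\<^sub>F m in sequentially. \<forall>j\<in>{..n}. (T (r m) - 2 * pi * of_int e) - Y (r m) j \<in> branch (l z j)"
      using topological_tendstoD[OF lim open_branch l[OF z]] by (intro eventually_ball_finite) auto
    then obtain m where m: "\<And>j. j \<le> n \<Longrightarrow> (T (r m) - 2 * pi * of_int e) - Y (r m) j \<in> branch (l z j)"
      using eventually_happens by force
    \<comment> \<open>If no argument changed, index 0 would show that the point did not move; then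
      no node moved either, contrary to the nonzero direction.\<close>
    have "\<exists>j\<le>n. (T (r m) - 2 * pi * of_int e) - Y (r m) j \<noteq> z - w j"
    proof (rule ccontr)
      assume "\<not> ?thesis"
      then have eq: "(T (r m) - 2 * pi * of_int e) - Y (r m) j = z - w j" if "j \<le> n" for j
        using that by auto
      then have "T (r m) - 2 * pi * of_int e = z" using eq[of 0] Y0 by simp
      then have "v0 j = 0" if "j \<le> n" for j using eq[OF that] by (simp add: Y_def)
      then show False using v(1) by (force simp: v0_def split: if_splits)
    qed
    from a[OF z m this]
    have "translate_sum n K (Y (r m)) (T (r m) - 2 * pi * of_int e)
        < M + ereal (\<Sum>j\<le>n. a z j * (w j - Y (r m) j))" .
    also have "(\<Sum>j\<le>n. a z j * (w j - Y (r m) j)) = - inverse (real (Suc (r m))) * (\<Sum>j\<le>n. a z j * v0 j)"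
      unfolding Y_def by (simp add: sum_distrib_left sum_negf[symmetric] algebra_simps)
    \<comment> \<open>The nodes move forward along \<open>v0\<close>, so the tangent correction is
      minus the step length times a nonnegative sum.\<close>
    also have "M + ereal (- inverse (real (Suc (r m))) * (\<Sum>j\<le>n. a z j * v0 j)) \<le> M + 0"
      using v0[OF z] by (intro add_left_mono) (simp add: mult_nonneg_nonneg)
    finally have "translate_sum n K (Y (r m)) (T (r m) - 2 * pi * of_int e) < M" by simp
    then show False
      using T(2)[of "r m"] translate_sum_periodic[where K = K, OF K, of n "Y (r m)" "T (r m)" "- e"] by simp
  qed
  then show ?thesis using that Y0 by blast
qed

text \<open>Injectivity says that consecutive nodes enclose at most one maximum point. Two points
  with the same last node share all branches, and the tangent bound at one of them is strict at the
  other.\<close>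

lemma max_point_last_node_inj:
  assumes w: "\<And>j. j \<le> n \<Longrightarrow> w j \<in> {0..<2*pi}" "w 0 = 0"
    and M: "\<And>t. translate_sum n K w t \<le> M"
    and Z: "Z = {t \<in> {0..<2*pi}. translate_sum n K w t = M}"
  shows "inj_on (\<lambda>z. Max {c \<in> w ` {..n}. c \<le> z}) Z"
proof (rule linorder_inj_onI)
  fix z z' assume zz: "z < z'" "z \<in> Z" "z' \<in> Z"
  have max: "translate_sum n K w t \<le> translate_sum n K w z" for t
    using M zz by (simp add: Z)
  \<comment> \<open>For a node to the right of \<open>z\<close> the difference lies in
    \<open>(-2 pi, 0)\<close>, which is branch -1.\<close>
  define l :: "nat \<Rightarrow> int" where "l j = (if w j \<le> z then 0 else -1)" for j
  have zw: "z \<noteq> w j" if "j \<le> n" for j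
    using max_point_in_branches[OF max that]
    by (auto simp: branch_def zero_less_mult_iff mult_less_0_iff)
  show "Max {c \<in> w ` {..n}. c \<le> z} \<noteq> Max {c \<in> w ` {..n}. c \<le> z'}"
  proof
    assume eq: "Max {c \<in> w ` {..n}. c \<le> z} = Max {c \<in> w ` {..n}. c \<le> z'}"
    have gap: "w j \<le> z \<or> z' < w j" if "j \<le> n" for j
    proof (rule ccontr)
      assume "\<not> ?thesis"
      then have j: "z < w j" "w j \<le> z'" by auto
      have "w j \<le> Max {c \<in> w ` {..n}. c \<le> z'}" using j that by (intro Max_ge) auto
      moreover have "0 \<in> w ` {..n}" using w(2) image_eqI[of 0 w 0 "{..n}"] by simp
      then have "0 \<in> {c \<in> w ` {..n}. c \<le> z}" using zz(2) by (simp add: Z)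
      then have "{c \<in> w ` {..n}. c \<le> z} \<noteq> {}" by blast
      then have "Max {c \<in> w ` {..n}. c \<le> z} \<in> {c \<in> w ` {..n}. c \<le> z}" by (intro Max_in) simp_all
      then have "Max {c \<in> w ` {..n}. c \<le> z} \<le> z" by simp
      ultimately show False using eq j by linarith
    qed
    have zb: "0 \<le> z" "z' < 2 * pi" using zz by (auto simp: Z)
    have b: "z - w j \<in> branch (l j) \<and> z' - w j \<in> branch (l j)" if "j \<le> n" for j
      using gap[OF that] zw[OF that] w(1)[OF that] zz(1) zb by (auto simp: l_def branch_def)
    have "\<And>j. j \<le> n \<Longrightarrow> z - w j \<in> branch (l j)" using b by blast
    from max_tangent[where K = K and l = l, OF K max this]
    obtain a where a: "\<And>y' t'. (\<forall>j\<le>n. t' - y' j \<in> branch (l j)) \<longrightarrow> (\<exists>j\<le>n. t' - y' j \<noteq> z - w j) \<longrightarrow>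
      translate_sum n K y' t' < translate_sum n K w z + ereal (\<Sum>j\<le>n. a j * (w j - y' j))"
      by auto
    \<comment> \<open>The nodes are left unchanged, so the linear correction vanishes.\<close>
    have "translate_sum n K w z' < translate_sum n K w z + ereal (\<Sum>j\<le>n. a j * (w j - w j))"
      using zz(1) b a[of z' w] by auto
    then show False using zz by (simp add: Z)
  qed
qed (rule linear)

end

section \<open>Simplices and the minimum\<close>

lemma ynode_chain_mono:
  assumes y: "\<forall>k\<in>{0..n}. ynode n y (\<sigma> k) < ynode n y (\<sigma> (k + 1))" and "i \<le> k" "k \<le> n + 1"
  shows "ynode n y (\<sigma> i) \<le> ynode n y (\<sigma> k)"
  using assms(2,3)
proof (induction k rule: dec_induct)
  case (step k)
  then have "ynode n y (\<sigma> k) < ynode n y (\<sigma> (Suc k))" using y by auto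
  then show ?case using step by auto
qed simp

lemma Ssimplex_ynode_mono:
  assumes "y \<in> Ssimplex n \<sigma>" "i \<le> k" "k \<le> n + 1"
  shows "ynode n y (\<sigma> i) \<le> ynode n y (\<sigma> k)"
  using assms by (intro ynode_chain_mono) (auto simp: Ssimplex_def)

lemma permutes_fixes_ends:
  fixes n :: nat
  assumes "\<sigma> permutes {1..n}"
  shows "\<sigma> 0 = 0" "\<sigma> (n + 1) = n + 1"
  using permutes_not_in[OF assms, of 0] permutes_not_in[OF assms, of "n + 1"] by auto

text \<open>Membership in \<open>nodes\<close> follows from the chain: every index has a position in
  the ordering, and the chain starts at 0 and ends at 2 pi.\<close>

lemma Ssimplex_I:
  assumes \<sigma>: "\<sigma> permutes {1..n}" and "y \<in> extensional {1..n}"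
    and chain: "\<forall>k\<in>{0..n}. ynode n y (\<sigma> k) < ynode n y (\<sigma> (k + 1))"
  shows "y \<in> Ssimplex n \<sigma>"
proof -
  note ends = permutes_fixes_ends[OF \<sigma>]
  have "y j \<in> {0..<2*pi}" if j: "j \<in> {1..n}" for j
  proof -
    define i where "i = inv \<sigma> j"
    have i: "j = \<sigma> i" "i \<in> {1..n}"
      using permutes_inverses[OF \<sigma>] permutes_in_image[OF permutes_inv[OF \<sigma>]] j by (auto simp: i_def)
    have "ynode n y (\<sigma> 0) \<le> ynode n y (\<sigma> i)" "ynode n y (\<sigma> (i + 1)) \<le> ynode n y (\<sigma> (n + 1))"
      using i by (auto intro!: ynode_chain_mono[OF chain])
    moreover have "ynode n y (\<sigma> i) < ynode n y (\<sigma> (i + 1))" using chain i by auto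
    moreover have "ynode n y (\<sigma> i) = y j" "ynode n y (\<sigma> 0) = 0" "ynode n y (\<sigma> (n + 1)) = 2 * pi"
      using i j ends by (auto simp: ynode_def)
    ultimately show ?thesis by auto
  qed
  then show ?thesis using assms by (auto simp: Ssimplex_def nodes_def PiE_def)
qed

text \<open>The branch depends only on the arc and on the position \<open>inv \<sigma> j\<close> of
  the node, not on \<open>y\<close> or \<open>t\<close>. Hence points from the same arc of two node
  systems in one simplex can be combined in \<open>translate_sum_concave\<close>.\<close>

lemma Ssimplex_arc_branches:
  assumes \<sigma>: "\<sigma> permutes {1..n}" and y: "y \<in> Ssimplex n \<sigma>" and k: "k \<le> n"
    and t: "t \<in> {ynode n y (\<sigma> k)<..<ynode n y (\<sigma> (k + 1))}" and j: "j \<le> n"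
  shows "t - (y(0 := 0)) j \<in> branch (if inv \<sigma> j \<le> k then 0 else -1)"
proof -
  note ends = permutes_fixes_ends[OF \<sigma>]
  define i where "i = inv \<sigma> j"
  have ji: "j = \<sigma> i" using permutes_inverses[OF \<sigma>] by (simp add: i_def)
  have "i \<le> n"
  proof (rule ccontr)
    assume "\<not> i \<le> n"
    then have "\<sigma> i = i" using \<sigma> by (auto simp: permutes_def)
    then show False using ji j \<open>\<not> i \<le> n\<close> by simp
  qed
  have yj: "(y(0 := 0)) j = ynode n y (\<sigma> i)" using j ji by (auto simp: ynode_def)
  have range: "0 \<le> ynode n y (\<sigma> m)" "ynode n y (\<sigma> m) \<le> 2 * pi" if "m \<le> n + 1" for m
    using Ssimplex_ynode_mono[OF y, of 0 m] Ssimplex_ynode_mono[OF y, of m "n + 1"] that ends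
    by (auto simp: ynode_def)
  have lt: "ynode n y (\<sigma> i) < 2 * pi"
    using Ssimplex_ynode_mono[OF y, of "i + 1" "n + 1"] y \<open>i \<le> n\<close> ends
    by (force simp: Ssimplex_def ynode_def)
  show ?thesis
  proof (cases "i \<le> k")
    case True
    then have "ynode n y (\<sigma> i) \<le> ynode n y (\<sigma> k)" using Ssimplex_ynode_mono[OF y] k by simp
    then show ?thesis
      using True t range[of "k + 1"] range[of i] \<open>i \<le> n\<close> k unfolding yj i_def[symmetric] by (auto simp: branch_def)
  next
    case False
    then have "ynode n y (\<sigma> (k + 1)) \<le> ynode n y (\<sigma> i)"
      using Ssimplex_ynode_mono[OF y] \<open>i \<le> n\<close> by simp
    then show ?thesis
      using False t range[of k] lt k unfolding yj i_def[symmetric] by (auto simp: branch_def)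
  qed
qed

text \<open>For the largest \<open>k\<close> up to \<open>n\<close> whose node is at most
  \<open>t\<close>, the next node is at least \<open>t\<close>. This works for arbitrary
  \<open>y\<close>.\<close>

lemma Ssimplex_arcs_cover:
  assumes \<sigma>: "\<sigma> permutes {1..n}" and t: "t \<in> {0..<2*pi}"
  obtains k where "k \<le> n" "t \<in> {ynode n y (\<sigma> k)..ynode n y (\<sigma> (k + 1))}"
proof -
  note ends = permutes_fixes_ends[OF \<sigma>]
  define A where "A = {k. k \<le> n \<and> ynode n y (\<sigma> k) \<le> t}"
  have "0 \<in> A" using t ends by (auto simp: A_def ynode_def)
  have "finite A" by (simp add: A_def)
  define k where "k = Max A"
  have k: "k \<in> A" using \<open>0 \<in> A\<close> \<open>finite A\<close> by (auto simp: k_def intro: Max_in)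
  have "t \<le> ynode n y (\<sigma> (k + 1))"
  proof (cases "k + 1 \<le> n")
    case True
    have "k + 1 \<notin> A" using Max_ge[OF \<open>finite A\<close>, of "k + 1"] by (auto simp: k_def)
    then show ?thesis using True by (simp add: A_def)
  next
    case False
    then have "k = n" using k by (simp add: A_def)
    then show ?thesis using ends t by (simp add: ynode_def)
  qed
  then show ?thesis using that[of k] k by (auto simp: A_def)
qed

section \<open>Existence of a minimizer and the lower half of the sandwich\<close>

context
  fixes n :: nat and K :: "nat \<Rightarrow> real \<Rightarrow> ereal"
  assumes K: "\<And>j. j \<le> n \<Longrightarrow> strictly_concave_kernel (K j)"
begin

lemma continuous_Fsum: "continuous_on UNIV (Fsum n K y)"
proof -
  have "(Fsum n K y \<longlongrightarrow> Fsum n K y t) (at t)" for t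
    unfolding Fsum_eq_translate_sum
    by (rule translate_sum_tendsto[where K = K, OF K]) (auto intro: tendsto_intros)
  then show ?thesis by (simp add: continuous_on_eq_continuous_at isCont_def)
qed

lemma Fsum_periodic: "Fsum n K y (t - 2 * pi * of_int l) = Fsum n K y t"
  using translate_sum_periodic[where K = K, OF K, of n "y(0 := 0)" t "- l"]
  by (simp add: Fsum_eq_translate_sum)

lemma Fsum_le_SUP: "Fsum n K y t \<le> (SUP t\<in>{0..<2*pi}. Fsum n K y t)"
proof -
  obtain l :: int where l: "t - 2 * pi * of_int l \<in> {0..<2*pi}" by (rule reduce_mod_2pi)
  have "Fsum n K y (t - 2 * pi * of_int l) \<le> (SUP t\<in>{0..<2*pi}. Fsum n K y t)"
    using l by (rule SUP_upper)
  then show ?thesis by (simp only: Fsum_periodic)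
qed

lemma Fsum_SUP_attained:
  obtains t where "t \<in> {0..<2*pi}" "Fsum n K y t = (SUP t\<in>{0..<2*pi}. Fsum n K y t)"
proof -
  have "\<exists>s\<in>{0..2*pi}. \<forall>t\<in>{0..2*pi}. Fsum n K y t \<le> Fsum n K y s"
    by (rule continuous_attains_sup) (auto intro: continuous_on_subset[OF continuous_Fsum])
  then obtain s where s: "\<And>t. t \<in> {0..2*pi} \<Longrightarrow> Fsum n K y t \<le> Fsum n K y s" by blast
  obtain l :: int where l: "s - 2 * pi * of_int l \<in> {0..<2*pi}" by (rule reduce_mod_2pi)
  have "(SUP t\<in>{0..<2*pi}. Fsum n K y t) \<le> Fsum n K y s"
    by (rule SUP_least) (use s in auto)
  then show ?thesis
    using that[OF l] Fsum_le_SUP[of y s] by (simp add: Fsum_periodic antisym)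
qed

text \<open>Limits and perturbations of node systems may leave \<open>[0, 2 pi)\<close>; they are
  brought back without changing \<open>Fsum\<close>.\<close>

lemma Fsum_reduce_nodes:
  obtains y' where "y' \<in> nodes n" "\<And>t. Fsum n K y' t = Fsum n K y t"
proof -
  have "\<forall>j. \<exists>l::int. y j - 2 * pi * of_int l \<in> {0..<2*pi}" using reduce_mod_2pi by metis
  then obtain l :: "nat \<Rightarrow> int" where l: "\<And>j. y j - 2 * pi * of_int (l j) \<in> {0..<2*pi}" by metis
  define y' where "y' = restrict (\<lambda>j. y j - 2 * pi * of_int (l j)) {1..n}"
  have "y' \<in> nodes n" using l by (auto simp: nodes_def y'_def)
  moreover have "\<exists>m::int. (y'(0 := 0)) j = (y(0 := 0)) j + 2 * pi * of_int m" if "j \<le> n" for j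
  proof (cases "j = 0")
    case True
    then show ?thesis by (intro exI[of _ 0]) simp
  next
    case False
    then show ?thesis using that by (intro exI[of _ "- l j"]) (simp add: y'_def)
  qed
  then have "Fsum n K y' t = Fsum n K y t" for t
    unfolding Fsum_eq_translate_sum by (intro translate_sum_cong_mod[where K = K, OF K])
  ultimately show ?thesis by (rule that)
qed

lemma INF_le_SUP_Fsum: "(INF y\<in>nodes n. SUP t\<in>{0..<2*pi}. Fsum n K y t) \<le> (SUP t\<in>{0..<2*pi}. Fsum n K y t)"
proof -
  obtain y' where y': "y' \<in> nodes n" "\<And>t. Fsum n K y' t = Fsum n K y t"
    using Fsum_reduce_nodes[of y] by blast
  have "(INF y\<in>nodes n. SUP t\<in>{0..<2*pi}. Fsum n K y t) \<le> (SUP t\<in>{0..<2*pi}. Fsum n K y' t)"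
    using y'(1) by (rule INF_lower)
  then show ?thesis by (simp add: y'(2))
qed

text \<open>A minimizing sequence has a convergent subsequence of nodes. Passing to the limit for
  each fixed \<open>t\<close> bounds the sum pointwise, hence its supremum, by the infimum.\<close>

lemma minimizer_exists:
  obtains w where "w \<in> nodes n"
    "(SUP t\<in>{0..<2*pi}. Fsum n K w t) = (INF y\<in>nodes n. SUP t\<in>{0..<2*pi}. Fsum n K y t)"
proof -
  define S where "S y = (SUP t\<in>{0..<2*pi}. Fsum n K y t)" for y
  have "restrict (\<lambda>_. 0) {1..n} \<in> nodes n" by (auto simp: nodes_def)
  then have "S ` nodes n \<noteq> {}" by blast
  then obtain u where u: "\<And>m. u m \<in> S ` nodes n" "u \<longlonglongrightarrow> (INF y\<in>nodes n. S y)"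
    using Inf_as_limit[of "S ` nodes n"] by blast
  then have "\<forall>m. \<exists>y\<in>nodes n. u m = S y" by blast
  then obtain Y where Y: "\<And>m. Y m \<in> nodes n" "\<And>m. u m = S (Y m)" by metis
  have "Y m j \<in> {0..2*pi}" if "j \<in> {1..n}" for m j
    using Y(1)[of m] that by (fastforce simp: nodes_def PiE_def Pi_def)
  then obtain r y where r: "strict_mono r" "\<forall>j\<in>{1..n}. y j \<in> {0..2*pi} \<and> (\<lambda>m. Y (r m) j) \<longlonglongrightarrow> y j"
    using simultaneous_convergent_subsequence[of "{1..n}" Y 0 "2*pi"] by blast
  have le: "Fsum n K y t \<le> (INF y\<in>nodes n. S y)" for t
  proof -
    have "(\<lambda>m. ((Y (r m))(0 := 0)) j) \<longlonglongrightarrow> (y(0 := 0)) j" if "j \<le> n" for j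
      using r(2) that by (cases "j = 0") auto
    then have "(\<lambda>m. Fsum n K (Y (r m)) t) \<longlonglongrightarrow> Fsum n K y t"
      unfolding Fsum_eq_translate_sum
      by (intro translate_sum_tendsto[where K = K, OF K]) auto
    moreover have "(\<lambda>m. S (Y (r m))) \<longlonglongrightarrow> (INF y\<in>nodes n. S y)"
      using LIMSEQ_subseq_LIMSEQ[OF u(2) r(1)] by (simp add: Y(2) o_def)
    moreover have "\<exists>N. \<forall>m\<ge>N. Fsum n K (Y (r m)) t \<le> S (Y (r m))"
      unfolding S_def using Fsum_le_SUP by blast
    ultimately show ?thesis by (rule LIMSEQ_le)
  qed
  \<comment> \<open>A limit coordinate may equal 2 pi, so the limit is reduced to a proper node
    system.\<close>
  obtain w where w: "w \<in> nodes n" "\<And>t. Fsum n K w t = Fsum n K y t"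
    using Fsum_reduce_nodes[of y] by blast
  have "S w \<le> (INF y\<in>nodes n. S y)"
    unfolding S_def w(2) by (rule SUP_least) (use le in \<open>simp add: S_def\<close>)
  moreover have "(INF y\<in>nodes n. S y) \<le> S w" using w(1) by (rule INF_lower)
  ultimately have "S w = (INF y\<in>nodes n. S y)" by (rule antisym)
  then show ?thesis using that[OF w(1)] by (simp add: S_def)
qed

lemma SUP_le_mbar:
  assumes \<sigma>: "\<sigma> permutes {1..n}"
  shows "(SUP t\<in>{0..<2*pi}. Fsum n K y t) \<le> mbar n K \<sigma> y"
proof (rule SUP_least)
  fix t :: real assume "t \<in> {0..<2*pi}"
  then obtain k where k: "k \<le> n" "t \<in> {ynode n y (\<sigma> k)..ynode n y (\<sigma> (k + 1))}"
    by (rule Ssimplex_arcs_cover[OF \<sigma>])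
  have "Fsum n K y t \<le> mloc n K \<sigma> y k" unfolding mloc_def using k(2) by (rule SUP_upper)
  also have "\<dots> \<le> mbar n K \<sigma> y" unfolding mbar_def using k(1) by (intro Max_ge) auto
  finally show "Fsum n K y t \<le> mbar n K \<sigma> y" .
qed

text \<open>If \<open>x\<close> exceeded \<open>M\<close> on every arc, then \<open>w\<close> would
  be a convex combination of \<open>x\<close> and a nearby \<open>y\<close> beyond \<open>w\<close>.
  On an arc where \<open>y\<close> reaches its maximum, at least \<open>M\<close>, concavity would
  lift the value for \<open>w\<close> above \<open>M\<close>.\<close>

lemma munder_le_minimum:
  assumes \<sigma>: "\<sigma> permutes {1..n}" and w: "w \<in> Ssimplex n \<sigma>" "\<And>t. Fsum n K w t \<le> ereal M"
    and min: "\<And>y. ereal M \<le> (SUP t\<in>{0..<2*pi}. Fsum n K y t)" and x: "x \<in> Ssimplex n \<sigma>"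
  shows "munder n K \<sigma> x \<le> ereal M"
proof (rule ccontr)
  assume "\<not> ?thesis"
  then have above: "ereal M < mloc n K \<sigma> x k" if "k \<le> n" for k
    using that by (simp add: munder_def not_le)
  note ends = permutes_fixes_ends[OF \<sigma>]
  define Y where "Y s = restrict (\<lambda>j. w j + s * (w j - x j)) {1..n}" for s :: real
  \<comment> \<open>The end nodes 0 and 2 pi obey the same formula, because they coincide for
    \<open>w\<close> and \<open>x\<close>.\<close>
  have node: "ynode n (Y s) j = ynode n w j + s * (ynode n w j - ynode n x j)" if "j \<le> n + 1" for s j
    using that by (auto simp: ynode_def Y_def)
  have \<sigma>_le: "\<sigma> k \<le> n + 1" if "k \<le> n + 1" for k
    using that permutes_in_image[OF \<sigma>, of k] ends by (cases "k \<in> {1..n}") (auto simp: not_le Suc_le_eq le_Suc_eq)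
  have lim: "((\<lambda>s. a + s * b) \<longlongrightarrow> a) (at_right 0)" for a b :: real
    by (auto intro!: tendsto_eq_intros)
  have "\<forall>\<^sub>F s in at_right 0. \<forall>k\<in>{0..n}. ynode n (Y s) (\<sigma> k) < ynode n (Y s) (\<sigma> (k + 1))"
  proof (rule eventually_ball_finite)
    show "\<forall>k\<in>{0..n}. \<forall>\<^sub>F s in at_right 0. ynode n (Y s) (\<sigma> k) < ynode n (Y s) (\<sigma> (k + 1))"
    proof
      fix k assume "k \<in> {0..n}"
      then have "ynode n w (\<sigma> k) < ynode n w (\<sigma> (k + 1))" "\<sigma> k \<le> n + 1" "\<sigma> (k + 1) \<le> n + 1"
        using w(1) \<sigma>_le by (auto simp: Ssimplex_def)
      moreover have lim': "((\<lambda>s. ynode n (Y s) j) \<longlongrightarrow> ynode n w j) (at_right 0)" if "j \<le> n + 1" for j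
        unfolding node[OF that] by (rule lim)
      ultimately show "\<forall>\<^sub>F s in at_right 0. ynode n (Y s) (\<sigma> k) < ynode n (Y s) (\<sigma> (k + 1))"
        using order_tendstoD(1)[OF tendsto_diff[OF lim'[of "\<sigma> (k + 1)"] lim'[of "\<sigma> k"]], of 0] by simp
    qed
  qed simp
  moreover have "\<forall>\<^sub>F s in at_right (0::real). 0 < s" by (simp add: eventually_at_right_less)
  ultimately have "\<forall>\<^sub>F s in at_right 0. 0 < s \<and> (\<forall>k\<in>{0..n}. ynode n (Y s) (\<sigma> k) < ynode n (Y s) (\<sigma> (k + 1)))"
    by eventually_elim simp
  then obtain s where s: "0 < s" "\<forall>k\<in>{0..n}. ynode n (Y s) (\<sigma> k) < ynode n (Y s) (\<sigma> (k + 1))"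
    using eventually_happens[of _ "at_right (0::real)"] by auto
  define y where "y = Y s"
  have y: "y \<in> Ssimplex n \<sigma>"
    unfolding y_def by (rule Ssimplex_I[OF \<sigma> _ s(2)]) (simp add: Y_def)
  have arc: "ynode n v (\<sigma> k) < ynode n v (\<sigma> (k + 1))" if "v \<in> Ssimplex n \<sigma>" "k \<le> n" for v k
    using that by (simp add: Ssimplex_def)
  \<comment> \<open>This arc is determined by \<open>y\<close>, which is why \<open>x\<close> has to
    lie above \<open>M\<close> on all arcs.\<close>
  have "mbar n K \<sigma> y \<in> mloc n K \<sigma> y ` {0..n}" unfolding mbar_def by (intro Max_in) auto
  then obtain k where k: "k \<le> n" "mbar n K \<sigma> y = mloc n K \<sigma> y k" by auto
  then have My: "ereal M \<le> mloc n K \<sigma> y k" using min[of y] SUP_le_mbar[OF \<sigma>, of y] by simp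
  obtain t where t: "t \<in> {ynode n x (\<sigma> k)<..<ynode n x (\<sigma> (k + 1))}" "ereal M < Fsum n K x t"
    using SUP_greater_interior[OF continuous_Fsum arc[OF x k(1)]] above[OF k(1)] unfolding mloc_def by blast
  note bx = Ssimplex_arc_branches[OF \<sigma> x k(1) t(1)]
  obtain \<beta> where \<beta>: "Fsum n K x t = ereal \<beta>" "M < \<beta>"
    using t(2) translate_sum_real[where K = K, OF K kernel_finite[OF K bx]]
    unfolding Fsum_eq_translate_sum by auto
  \<comment> \<open>The permitted deficit of \<open>y\<close> below \<open>M\<close> is what the
    excess of \<open>x\<close> compensates when the weights are in the ratio 1 to
    \<open>s\<close>.\<close>
  have "ereal (M - s * (\<beta> - M)) < ereal M" using s(1) \<beta>(2) by simp
  then have "ereal (M - s * (\<beta> - M)) < mloc n K \<sigma> y k" using My by (rule less_le_trans)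
  then obtain t' where t': "t' \<in> {ynode n y (\<sigma> k)<..<ynode n y (\<sigma> (k + 1))}"
      "ereal (M - s * (\<beta> - M)) < Fsum n K y t'"
    using SUP_greater_interior[OF continuous_Fsum arc[OF y k(1)]] unfolding mloc_def by blast
  note b_y = Ssimplex_arc_branches[OF \<sigma> y k(1) t'(1)]
  obtain \<alpha> where \<alpha>: "Fsum n K y t' = ereal \<alpha>" "M - s * (\<beta> - M) < \<alpha>"
    using t'(2) translate_sum_real[where K = K, OF K kernel_finite[OF K b_y]]
    unfolding Fsum_eq_translate_sum by auto
  \<comment> \<open>The weight for which \<open>u * y + (1 - u) * x\<close> recovers
    \<open>w\<close>.\<close>
  define u where "u = 1 / (1 + s)"
  have u: "0 < u" "u < 1" "u * (1 + s) = 1" using s(1) by (auto simp: u_def)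
  have "ereal (u * \<alpha> + (1 - u) * \<beta>)
      \<le> translate_sum n K (\<lambda>j. u * (y(0 := 0)) j + (1 - u) * (x(0 := 0)) j) (u * t' + (1 - u) * t)"
    by (rule translate_sum_concave[where K = K, OF K b_y bx u(1,2)])
      (use \<alpha>(1) \<beta>(1) in \<open>simp_all only: Fsum_eq_translate_sum\<close>)
  also have "\<dots> = translate_sum n K (w(0 := 0)) (u * t' + (1 - u) * t)"
  proof (rule translate_sum_cong_mod[where K = K, OF K])
    fix j assume j: "j \<le> n"
    have "u * (w j + s * (w j - x j)) + (1 - u) * x j = (u * (1 + s)) * w j + (1 - u * (1 + s)) * x j"
      by (simp add: algebra_simps)
    then have "u * (w j + s * (w j - x j)) + (1 - u) * x j = w j" by (simp add: u(3))
    \<comment> \<open>The combination is compared with \<open>w\<close> on indices up to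
      \<open>n\<close> only, with shift 0.\<close>
    then show "\<exists>l::int. u * (y(0 := 0)) j + (1 - u) * (x(0 := 0)) j = (w(0 := 0)) j + 2 * pi * of_int l"
      using j by (intro exI[of _ 0]) (simp add: y_def Y_def)
  qed
  also have "\<dots> \<le> ereal M" using w(2) by (simp add: Fsum_eq_translate_sum)
  finally have "u * \<alpha> + (1 - u) * \<beta> \<le> M" by simp
  then have "(u * \<alpha> + (1 - u) * \<beta>) * (1 + s) \<le> M * (1 + s)" using s(1) by (intro mult_right_mono) auto
  moreover have "(u * \<alpha> + (1 - u) * \<beta>) * (1 + s) = (u * (1 + s)) * \<alpha> + (1 + s - u * (1 + s)) * \<beta>"
    by (simp add: algebra_simps)
  ultimately have "\<alpha> + s * \<beta> \<le> M * (1 + s)" by (simp add: u(3))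
  then show False using \<alpha>(2) by (simp add: algebra_simps)
qed

end

section \<open>Counting maximum points and assembling the statement\<close>

theorem theorem11p1:
  fixes n :: nat and K :: "nat \<Rightarrow> real \<Rightarrow> ereal"
  assumes "n \<ge> 1"
    and "\<forall>j\<in>{0..n}. strictly_concave_kernel (K j)"
    and "(\<forall>j\<in>{0..n}. cond_infty' (K j)) \<or> (\<forall>j\<in>{0..n}. C1_kernel (K j))"
  shows "\<exists>w\<in>nodes n.
     (INF y\<in>nodes n. SUP t\<in>{0..<2*pi}. Fsum n K y t) = (SUP t\<in>{0..<2*pi}. Fsum n K w t)
   \<and> (\<exists>\<sigma>. \<sigma> permutes {1..n} \<and> w \<in> Ssimplex n \<sigma>
       \<and> equioscillation n K \<sigma> w
       \<and> (INF y\<in>Ssimplex n \<sigma>. mbar n K \<sigma> y) = (INF y\<in>nodes n. SUP t\<in>{0..<2*pi}. Fsum n K y t)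
       \<and> (SUP y\<in>Ssimplex n \<sigma>. munder n K \<sigma> y) = (INF y\<in>nodes n. SUP t\<in>{0..<2*pi}. Fsum n K y t)
       \<and> (\<forall>x\<in>Ssimplex n \<sigma>. \<forall>y\<in>Ssimplex n \<sigma>.
            munder n K \<sigma> x \<le> (INF y\<in>nodes n. SUP t\<in>{0..<2*pi}. Fsum n K y t)
          \<and> (INF y\<in>nodes n. SUP t\<in>{0..<2*pi}. Fsum n K y t) \<le> mbar n K \<sigma> y))"
proof -
  have K: "strictly_concave_kernel (K j)" if "j \<le> n" for j using assms(2) that by simp
  have smooth: "(\<forall>j\<le>n. cond_infty' (K j)) \<or> (\<forall>j\<le>n. C1_kernel (K j))" using assms(3) by auto
  define M where "M = (INF y\<in>nodes n. SUP t\<in>{0..<2*pi}. Fsum n K y t)"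
  obtain w where w: "w \<in> nodes n" "(SUP t\<in>{0..<2*pi}. Fsum n K w t) = M"
    using minimizer_exists[where K = K, OF K] unfolding M_def by blast
  have min: "M \<le> (SUP t\<in>{0..<2*pi}. Fsum n K y t)" for y
    unfolding M_def by (rule INF_le_SUP_Fsum[where K = K, OF K])
  have wM: "Fsum n K w t \<le> M" for t
    using Fsum_le_SUP[where K = K, OF K, of n w t] w(2) by simp
  define w0 where "w0 = w(0 := 0)"
  have w0M: "translate_sum n K w0 t \<le> M" for t
    using wM by (simp only: Fsum_eq_translate_sum w0_def)
  obtain t0 where "Fsum n K w t0 = M"
    using Fsum_SUP_attained[where K = K, OF K, of n w] w(2) by metis
  then have t0: "translate_sum n K w0 t0 = M" by (simp only: Fsum_eq_translate_sum w0_def)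
  have "M \<noteq> \<infinity>" using translate_sum_not_PInf[where K = K, OF K, of n w0 t0] t0 by simp
  moreover have "M \<noteq> -\<infinity>" using max_finite[where K = K, OF K, of n w0 t0] t0 w0M by simp
  ultimately obtain Mr where Mr: "M = ereal Mr" by (cases M) auto

  define Z where "Z = {t \<in> {0..<2*pi}. translate_sum n K w0 t = M}"
  \<comment> \<open>The last node not after \<open>z\<close>; counting values of \<phi> relates
    maximum points to nodes.\<close>
  define \<phi> where "\<phi> z = Max {c \<in> w0 ` {..n}. c \<le> z}" for z
  have w0_range: "w0 j \<in> {0..<2*pi}" if "j \<le> n" for j
    using w(1) that by (cases "j = 0") (auto simp: w0_def nodes_def PiE_def Pi_def)
  have w0_0: "w0 0 = 0" by (simp add: w0_def)
  have inj: "inj_on \<phi> Z"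
    unfolding \<phi>_def
    by (rule max_point_last_node_inj[where K = K, OF assms(1) K smooth w0_range w0_0 w0M Z_def])
  have \<phi>_in: "\<phi> z \<in> {c \<in> w0 ` {..n}. c \<le> z}" if "z \<in> Z" for z
  proof -
    have "0 \<in> w0 ` {..n}" using w0_0 image_eqI[of 0 w0 0 "{..n}"] by simp
    then have "{c \<in> w0 ` {..n}. c \<le> z} \<noteq> {}" using that by (auto simp only: Z_def atLeastLessThan_iff)
    then show ?thesis unfolding \<phi>_def by (intro Max_in) simp_all
  qed
  then have sub: "\<phi> ` Z \<subseteq> w0 ` {..n}" by blast
  have "finite Z" using inj_on_finite[OF inj sub] by simp
  have "card Z \<ge> n + 1"
  proof (rule ccontr)
    assume "\<not> ?thesis"
    then have "card Z \<le> n" by simp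
    then obtain y where y: "y 0 = w0 0" "\<And>t. translate_sum n K y t < M"
      using improving_perturbation[where K = K, OF assms(1) K smooth w0M Z_def \<open>finite Z\<close>] by blast
    have "y(0 := 0) = y" using y(1) w0_0 by auto
    \<comment> \<open>The supremum is attained, so these pointwise strict bounds put it strictly
      below the infimum \<open>M\<close>.\<close>
    then have "Fsum n K y t < M" for t using y(2) by (simp add: Fsum_eq_translate_sum)
    moreover obtain t where "Fsum n K y t = (SUP t\<in>{0..<2*pi}. Fsum n K y t)"
      using Fsum_SUP_attained[where K = K, OF K, of n y] by metis
    ultimately show False using min[of y] by (metis not_le)
  qed
  moreover have "card (w0 ` {..n}) \<le> n + 1" using card_image_le[of "{..n}" w0] by simp
  moreover have "card (\<phi> ` Z) = card Z" using inj by (rule card_image)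
  moreover have "card (\<phi> ` Z) \<le> card (w0 ` {..n})" using sub by (intro card_mono) auto
  \<comment> \<open>The number of maximum points is at least \<open>n + 1\<close> and at most the
    number of distinct nodes, itself at most \<open>n + 1\<close>. Equality throughout makes the
    nodes distinct and each of them the last node before some maximum point.\<close>
  ultimately have card: "card (\<phi> ` Z) = card (w0 ` {..n})" "card (w0 ` {..n}) = card {..n}" by auto
  have surj: "\<phi> ` Z = w0 ` {..n}" using card_subset_eq[OF _ sub card(1)] by simp
  have inj_w0: "inj_on w0 {..n}" using eq_card_imp_inj_on[OF _ card(2)] by simp
  have "inj_on w {1..n}"
  proof (rule inj_onI)
    fix i j assume "i \<in> {1..n}" "j \<in> {1..n}" "w i = w j"
    then show "i = j" using inj_onD[OF inj_w0, of i j] by (simp add: w0_def)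
  qed
  then obtain \<sigma> where \<sigma>: "\<sigma> permutes {1..n}"
      "\<forall>i j. 1 \<le> i \<and> i < j \<and> j \<le> n \<longrightarrow> w (\<sigma> i) < w (\<sigma> j)"
    using sorting_permutation by blast
  note ends = permutes_fixes_ends[OF \<sigma>(1)]
  have \<sigma>_in: "\<sigma> k \<in> {1..n}" if "k \<in> {1..n}" for k
    using permutes_in_image[OF \<sigma>(1)] that by blast
  have node: "ynode n w (\<sigma> k) = w0 (\<sigma> k)" "\<sigma> k \<le> n" if "k \<le> n" for k
    using that \<sigma>_in[of k] ends by (cases "k = 0"; auto simp: ynode_def w0_def)+
  have pos: "0 < w j" if "j \<in> {1..n}" for j
  proof -
    have "w0 j \<noteq> w0 0" using inj_on_eq_iff[OF inj_w0, of j 0] that by auto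
    then show ?thesis using w0_range[of j] that by (auto simp: w0_def)
  qed
  have chain: "ynode n w (\<sigma> k) < ynode n w (\<sigma> (k + 1))" if "k \<le> n" for k
  proof (cases "k = n")
    case True
    then show ?thesis using node[OF that] w0_range ends by (simp add: ynode_def)
  next
    case False
    then have k: "k + 1 \<le> n" using that by simp
    show ?thesis
    proof (cases "k = 0")
      case True
      then show ?thesis using pos[OF \<sigma>_in[of "k + 1"]] \<sigma>_in[of "k + 1"] node[OF k] k ends
        by (simp add: ynode_def)
    next
      case False
      then show ?thesis using \<sigma>(2)[rule_format, of k "k + 1"] \<sigma>_in[of k] \<sigma>_in[of "k + 1"] k by (simp add: ynode_def)
    qed
  qed
  then have wS: "w \<in> Ssimplex n \<sigma>" using w(1) by (simp add: Ssimplex_def)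

  have mloc: "mloc n K \<sigma> w k = M" if k: "k \<le> n" for k
  proof (rule antisym)
    show "mloc n K \<sigma> w k \<le> M" unfolding mloc_def by (rule SUP_least) (rule wM)
    \<comment> \<open>The maximum point assigned to node \<open>\<sigma> k\<close> is shown to lie
      in arc \<open>k\<close>: beyond the next node, that node would bound \<phi> from
      below.\<close>
    have "w0 (\<sigma> k) \<in> \<phi> ` Z" unfolding surj using node[OF k] by simp
    then obtain z where z: "z \<in> Z" "\<phi> z = w0 (\<sigma> k)" by (metis imageE)
    have "ynode n w (\<sigma> k) \<le> z" using \<phi>_in[OF z(1)] z(2) node[OF k] by simp
    moreover have "z \<le> ynode n w (\<sigma> (k + 1))"
    proof (cases "k = n")
      case True
      then show ?thesis using z(1) ends by (simp add: Z_def ynode_def)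
    next
      case False
      then have k': "k + 1 \<le> n" using k by simp
      show ?thesis
      proof (rule ccontr)
        assume "\<not> ?thesis"
        then have "w0 (\<sigma> (k + 1)) \<le> \<phi> z"
          unfolding \<phi>_def using node[OF k'] by (intro Max_ge) auto
        moreover have "w0 (\<sigma> k) < w0 (\<sigma> (k + 1))"
          using chain[OF k] node[OF k] node[OF k'] by simp
        ultimately show False using z(2) by simp
      qed
    qed
    ultimately have "Fsum n K w z \<le> mloc n K \<sigma> w k" unfolding mloc_def by (intro SUP_upper) simp
    moreover have "Fsum n K w z = M" using z(1) by (simp only: Fsum_eq_translate_sum Z_def w0_def mem_Collect_eq)
    ultimately show "M \<le> mloc n K \<sigma> w k" by simp
  qed
  then have img: "mloc n K \<sigma> w ` {0..n} = {M}" by force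
  have bar: "mbar n K \<sigma> w = M" and under: "munder n K \<sigma> w = M"
    by (simp_all add: mbar_def munder_def img)
  have equi: "equioscillation n K \<sigma> w" using mloc by (simp add: equioscillation_def)
  have upper: "M \<le> mbar n K \<sigma> y" for y
    using min[of y] SUP_le_mbar[where K = K, OF K \<sigma>(1), of y] by (rule order_trans)
  have lower: "munder n K \<sigma> x \<le> M" if "x \<in> Ssimplex n \<sigma>" for x
    using munder_le_minimum[where K = K, OF K \<sigma>(1) wS _ _ that, of Mr] wM min unfolding Mr by blast
  have "(INF y\<in>Ssimplex n \<sigma>. mbar n K \<sigma> y) = M"
    using wS bar upper by (intro antisym INF_lower2[OF wS] INF_greatest) auto
  moreover have "(SUP y\<in>Ssimplex n \<sigma>. munder n K \<sigma> y) = M"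
    using under lower by (intro antisym SUP_upper2[OF wS] SUP_least) auto
  ultimately show ?thesis
    unfolding M_def[symmetric] using w \<sigma>(1) wS equi upper lower by metis
qed

end
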